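(* Let $(\mathfrak H_n)_{n\in\mathbb Z}$, $\mathfrak H_{n+1}\subseteq\mathfrak H_n$, be the scale of Hilbert spaces associated with a lower semibounded self-adjoint operator $L$ in $\mathfrak H_0$. For each $n\in\mathbb Z$ let $P_n^-$ be an orthogonal projection in $\mathfrak H_n$ onto a subspace $\mathfrak H_n^-\subseteq\mathfrak H_n$, and let $\mathfrak H_n^+$ be the orthogonal complement of $\mathfrak H_n^-$ in $\mathfrak H_n$. Assume that $P_{n+1}^-\subseteq P_n^-$ for all $n\in\mathbb Z$. Then the family $(P_n^-)_{n\in\mathbb Z}$ is characterized, by scaling, by any two adjacent projections; for the pair $P_0^-,P_1^-$ this reads $$P_{2n}^-=b_n(L)^{-1}P_0^-b_n(L),\qquad P_{2n+1}^-=b_n(L)^{-1}P_1^-b_n(L)\qquad(n\in\mathbb Z).$$ For each $n\in\mathbb Z$, the subspace $\mathfrak H_n^-$ (resp. $\mathfrak H_n^+$) is a reducing subspace for the operator $L_n$, the restriction of $L$ to $\mathfrak H_{n+2}$, considered in $\mathfrak H_n$. The part of $L_n$ in $\mathfrak H_n^-$ (resp. $\mathfrak H_n^+$) is a self-adjoint operator.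
   Context: Fix a real $z_1<\inf\sigma(L)$ and put $b_n(L):=(L-z_1)^n$, $n\in\mathbb Z$. $\mathfrak H_n=\operatorname{dom}b_n(L)^{1/2}$ for $n\ge0$, and for $n<0$ it is the completion of $\mathfrak H_0$, with inner product $\langle f,g\rangle_n:=\langle b_n(L)^{1/2}f,b_n(L)^{1/2}g\rangle_0$; $\mathfrak H_2=\operatorname{dom}L$. The operators $b_l(L)^{1/2}$ are regarded as unitary maps $\mathfrak H_k\to\mathfrak H_{k-l}$ for all $k,l\in\mathbb Z$ (so $b_n(L):\mathfrak H_k\to\mathfrak H_{k-2n}$). $L$ acts on the whole scale (by continuous extension on the negative part); $L_n:=L|_{\mathfrak H_{n+2}}$ is the corresponding self-adjoint operator in $\mathfrak H_n$ with domain $\mathfrak H_{n+2}$. The inclusion $P_{n+1}^-\subseteq P_n^-$ is inclusion of graphs: $P_n^-f=P_{n+1}^-f$ for all $f\in\mathfrak H_{n+1}$. *)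

theory Defs
  imports "HOL-Analysis.Analysis" "HOL-Library.Extended_Real"
begin

text \<open>
  All spaces of a scale live on carriers inside one ambient complex vector space \<open>'a\<close>, so that
  the embeddings of the scale are genuine inclusions of sets.  Operators are identified with
  their graphs; hence extension of operators is \<open>\<subseteq>\<close>, the inverse is \<open>\<inverse>\<close>, and \<open>A O B\<close> is the
  operator product \<open>BA\<close> (first \<open>A\<close>, then \<open>B\<close>) with its natural domain.
\<close>

section \<open>Hilbert spaces on a carrier\<close>

definition hnorm :: "('a \<Rightarrow> 'a \<Rightarrow> complex) \<Rightarrow> 'a \<Rightarrow> real"
  where "hnorm ip f = sqrt (Re (ip f f))"

text \<open>Cut off outside the carrier, because \<^locale>\<open>Metric_space\<close> wants symmetry and
  nonnegativity on the whole type.\<close>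

definition hdist :: "'a::ab_group_add set \<Rightarrow> ('a \<Rightarrow> 'a \<Rightarrow> complex) \<Rightarrow> 'a \<Rightarrow> 'a \<Rightarrow> real"
  where "hdist H ip f g = (if f \<in> H \<and> g \<in> H then hnorm ip (f - g) else 0)"

abbreviation htop :: "'a::ab_group_add set \<Rightarrow> ('a \<Rightarrow> 'a \<Rightarrow> complex) \<Rightarrow> 'a topology"
  where "htop H ip \<equiv> Metric_space.mtopology H (hdist H ip)"

locale hilbert_space = vector_space smul
  for smul :: "complex \<Rightarrow> 'a::ab_group_add \<Rightarrow> 'a" +
  fixes H :: "'a set" and ip :: "'a \<Rightarrow> 'a \<Rightarrow> complex"
  assumes subspace_carrier: "subspace H"
    and ip_add_left: "\<lbrakk>x \<in> H; y \<in> H; z \<in> H\<rbrakk> \<Longrightarrow> ip (x + y) z = ip x z + ip y z"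
    and ip_scale_left: "\<lbrakk>x \<in> H; y \<in> H\<rbrakk> \<Longrightarrow> ip (smul c x) y = c * ip x y"
    and ip_commute: "\<lbrakk>x \<in> H; y \<in> H\<rbrakk> \<Longrightarrow> ip y x = cnj (ip x y)"
    and ip_pos: "\<lbrakk>x \<in> H; x \<noteq> 0\<rbrakk> \<Longrightarrow> 0 < Re (ip x x)"
    and complete: "Metric_space.mcomplete H (hdist H ip)"

definition closed_subspace ::
  "(complex \<Rightarrow> 'a::ab_group_add \<Rightarrow> 'a) \<Rightarrow> 'a set \<Rightarrow> ('a \<Rightarrow> 'a \<Rightarrow> complex) \<Rightarrow> 'a set \<Rightarrow> bool"
  where "closed_subspace smul H ip M \<longleftrightarrow> module.subspace smul M \<and> closedin (htop H ip) M"

definition orth_complement :: "'a set \<Rightarrow> ('a \<Rightarrow> 'a \<Rightarrow> complex) \<Rightarrow> 'a set \<Rightarrow> 'a set"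
  where "orth_complement H ip M = {g \<in> H. \<forall>f\<in>M. ip f g = 0}"

section \<open>Operators in a Hilbert space\<close>

definition linear_operator ::
  "(complex \<Rightarrow> 'a::ab_group_add \<Rightarrow> 'a) \<Rightarrow> 'a set \<Rightarrow> ('a \<times> 'a) set \<Rightarrow> bool"
  where "linear_operator smul H A \<longleftrightarrow>
    A \<subseteq> H \<times> H \<and> single_valued A \<and> module.subspace (\<lambda>c (f, g). (smul c f, smul c g)) A"

definition op_adjoint ::
  "'a set \<Rightarrow> ('a \<Rightarrow> 'a \<Rightarrow> complex) \<Rightarrow> ('a \<times> 'a) set \<Rightarrow> ('a \<times> 'a) set"
  where "op_adjoint H ip A = {(g, h) \<in> H \<times> H. \<forall>(f, k)\<in>A. ip k g = ip f h}"

definition self_adjoint ::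
  "(complex \<Rightarrow> 'a::ab_group_add \<Rightarrow> 'a) \<Rightarrow> 'a set \<Rightarrow> ('a \<Rightarrow> 'a \<Rightarrow> complex) \<Rightarrow> ('a \<times> 'a) set \<Rightarrow> bool"
  where "self_adjoint smul H ip A \<longleftrightarrow>
    linear_operator smul H A \<and> htop H ip closure_of (Domain A) = H \<and> op_adjoint H ip A = A"

definition lower_semibounded :: "('a \<Rightarrow> 'a \<Rightarrow> complex) \<Rightarrow> ('a \<times> 'a) set \<Rightarrow> bool"
  where "lower_semibounded ip A \<longleftrightarrow> (\<exists>c::real. \<forall>(f, g)\<in>A. c * Re (ip f f) \<le> Re (ip g f))"

text \<open>The operator \<open>A - z\<close>.\<close>

definition op_shift ::
  "(complex \<Rightarrow> 'a::ab_group_add \<Rightarrow> 'a) \<Rightarrow> ('a \<times> 'a) set \<Rightarrow> complex \<Rightarrow> ('a \<times> 'a) set"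
  where "op_shift smul A z = {(f, g - smul z f) | f g. (f, g) \<in> A}"

definition resolvent_set ::
  "(complex \<Rightarrow> 'a::ab_group_add \<Rightarrow> 'a) \<Rightarrow> 'a set \<Rightarrow> ('a \<Rightarrow> 'a \<Rightarrow> complex) \<Rightarrow> ('a \<times> 'a) set
    \<Rightarrow> complex set"
  where "resolvent_set smul H ip A = {z.
    single_valued ((op_shift smul A z)\<inverse>) \<and> Range (op_shift smul A z) = H \<and>
    (\<exists>C. \<forall>(f, g)\<in>op_shift smul A z. hnorm ip f \<le> C * hnorm ip g)}"

definition spectrum ::
  "(complex \<Rightarrow> 'a::ab_group_add \<Rightarrow> 'a) \<Rightarrow> 'a set \<Rightarrow> ('a \<Rightarrow> 'a \<Rightarrow> complex) \<Rightarrow> ('a \<times> 'a) set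
    \<Rightarrow> complex set"
  where "spectrum smul H ip A = - resolvent_set smul H ip A"

text \<open>Integer powers of an injective operator in \<open>H\<close>; the zeroth power is the identity of \<open>H\<close>.\<close>

definition op_power :: "'a set \<Rightarrow> ('a \<times> 'a) set \<Rightarrow> int \<Rightarrow> ('a \<times> 'a) set"
  where "op_power H A n =
    Id_on H O (if 0 \<le> n then A ^^ nat n else (A\<inverse>) ^^ nat (- n))"

text \<open>\<open>S = A\<^sup>1\<^sup>/\<^sup>2\<close>: a nonnegative self-adjoint operator with square \<open>A\<close> (domains included).  For a
  nonnegative self-adjoint \<open>A\<close> exactly one such \<open>S\<close> exists.\<close>

definition is_positive_sqrt ::
  "(complex \<Rightarrow> 'a::ab_group_add \<Rightarrow> 'a) \<Rightarrow> 'a set \<Rightarrow> ('a \<Rightarrow> 'a \<Rightarrow> complex)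
    \<Rightarrow> ('a \<times> 'a) set \<Rightarrow> ('a \<times> 'a) set \<Rightarrow> bool"
  where "is_positive_sqrt smul H ip A S \<longleftrightarrow>
    self_adjoint smul H ip S \<and> (\<forall>(f, g)\<in>S. 0 \<le> Re (ip g f)) \<and> S O S = A"

text \<open>\<open>P = P\<^sup>2 = P\<^sup>*\<close> everywhere defined in \<open>H\<close>, with range \<open>M\<close>.\<close>

definition is_orth_projection ::
  "(complex \<Rightarrow> 'a::ab_group_add \<Rightarrow> 'a) \<Rightarrow> 'a set \<Rightarrow> ('a \<Rightarrow> 'a \<Rightarrow> complex)
    \<Rightarrow> 'a set \<Rightarrow> ('a \<times> 'a) set \<Rightarrow> bool"
  where "is_orth_projection smul H ip M P \<longleftrightarrow>
    linear_operator smul H P \<and> Domain P = H \<and> P O P = P \<and> op_adjoint H ip P = P \<and> Range P = M"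

text \<open>\<open>dom A = (dom A \<inter> M) \<oplus> (dom A \<inter> M\<^sup>\<bottom>)\<close>, and \<open>A\<close> maps the two summands into \<open>M\<close> and
  \<open>M\<^sup>\<bottom>\<close>, respectively.\<close>

definition reducing_subspace ::
  "(complex \<Rightarrow> 'a::ab_group_add \<Rightarrow> 'a) \<Rightarrow> 'a set \<Rightarrow> ('a \<Rightarrow> 'a \<Rightarrow> complex)
    \<Rightarrow> ('a \<times> 'a) set \<Rightarrow> 'a set \<Rightarrow> bool"
  where "reducing_subspace smul H ip A M \<longleftrightarrow>
    closed_subspace smul H ip M \<and>
    Domain A =
      {p + q | p q. p \<in> Domain A \<inter> M \<and> q \<in> Domain A \<inter> orth_complement H ip M} \<and>
    A `` M \<subseteq> M \<and> A `` orth_complement H ip M \<subseteq> orth_complement H ip M"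

definition part_in :: "('a \<times> 'a) set \<Rightarrow> 'a set \<Rightarrow> ('a \<times> 'a) set"
  where "part_in A M = {(f, g) \<in> A. f \<in> M}"

section \<open>The scale of Hilbert spaces of a lower semibounded operator\<close>

text \<open>\<open>b\<^sub>n(L) = (L - z\<^sub>1)\<^sup>n\<close> as an operator in the base space \<open>H\<close>.\<close>

definition b_base ::
  "(complex \<Rightarrow> 'a::ab_group_add \<Rightarrow> 'a) \<Rightarrow> 'a set \<Rightarrow> ('a \<times> 'a) set \<Rightarrow> real \<Rightarrow> int \<Rightarrow> ('a \<times> 'a) set"
  where "b_base smul H L z1 n = op_power H (op_shift smul L (complex_of_real z1)) n"

text \<open>
  \<open>S\<close> below is \<open>b\<^sub>n(L)\<^sup>1\<^sup>/\<^sup>2\<close>.  For \<open>n \<ge> 0\<close> the space \<open>\<HH>\<^sub>n\<close> is its domain; for \<open>n < 0\<close> the (complete)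
  space \<open>\<HH>\<^sub>n\<close> contains \<open>\<HH>\<^sub>0 = dom S\<close> densely.  In both cases the inner product on \<open>dom S\<close> is
  \<open>\<langle>f, g\<rangle>\<^sub>n = \<langle>S f, S g\<rangle>\<^sub>0\<close>.  A completion is only determined up to isomorphism; continuity of the
  embeddings makes \<open>\<HH>\<^sub>n\<^sub>+\<^sub>1 \<subseteq> \<HH>\<^sub>n\<close> the canonical one also for \<open>n < -1\<close>.
\<close>

definition hilbert_scale ::
  "(complex \<Rightarrow> 'a::ab_group_add \<Rightarrow> 'a) \<Rightarrow> ('a \<times> 'a) set \<Rightarrow> real
    \<Rightarrow> (int \<Rightarrow> 'a set) \<Rightarrow> (int \<Rightarrow> 'a \<Rightarrow> 'a \<Rightarrow> complex) \<Rightarrow> bool"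
  where "hilbert_scale smul L z1 H ip \<longleftrightarrow>
    (\<forall>n. hilbert_space smul (H n) (ip n)) \<and>
    (\<forall>n. \<exists>S. is_positive_sqrt smul (H 0) (ip 0) (b_base smul (H 0) L z1 n) S \<and>
       (if 0 \<le> n then H n = Domain S
        else H 0 \<subseteq> H n \<and> htop (H n) (ip n) closure_of (H 0) = H n) \<and>
       (\<forall>(f, f')\<in>S. \<forall>(g, g')\<in>S. ip n f g = ip 0 f' g')) \<and>
    (\<forall>n. H (n + 1) \<subseteq> H n \<and>
       continuous_map (htop (H (n + 1)) (ip (n + 1))) (htop (H n) (ip n)) (\<lambda>f. f))"

text \<open>
  The operator from \<open>\<HH>\<^sub>k\<close> to \<open>\<HH>\<^sub>m\<close> induced by an operator \<open>T\<close> in \<open>\<HH>\<^sub>0\<close>: restrict \<open>T\<close> to arguments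
  in \<open>\<HH>\<^sub>k\<close> with value in \<open>\<HH>\<^sub>m\<close> and extend by continuity, i.e. close the graph in \<open>\<HH>\<^sub>k \<times> \<HH>\<^sub>m\<close>.
\<close>

definition scale_op ::
  "(int \<Rightarrow> 'a::ab_group_add set) \<Rightarrow> (int \<Rightarrow> 'a \<Rightarrow> 'a \<Rightarrow> complex) \<Rightarrow> ('a \<times> 'a) set \<Rightarrow> int \<Rightarrow> int
    \<Rightarrow> ('a \<times> 'a) set"
  where "scale_op H ip T k m = {(f, g).
    \<exists>X Y. (\<forall>j. (X j, Y j) \<in> T \<inter> H k \<times> H m) \<and>
      limitin (htop (H k) (ip k)) X f sequentially \<and>
      limitin (htop (H m) (ip m)) Y g sequentially}"

text \<open>\<open>L\<^sub>n : \<HH>\<^sub>n\<^sub>+\<^sub>2 \<rightarrow> \<HH>\<^sub>n\<close>; for \<open>n \<ge> 0\<close> no closure is needed and this is the restriction of \<open>L\<close>.\<close>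

definition L_op ::
  "(int \<Rightarrow> 'a::ab_group_add set) \<Rightarrow> (int \<Rightarrow> 'a \<Rightarrow> 'a \<Rightarrow> complex) \<Rightarrow> ('a \<times> 'a) set \<Rightarrow> int
    \<Rightarrow> ('a \<times> 'a) set"
  where "L_op H ip L n = scale_op H ip L (n + 2) n"

text \<open>\<open>b\<^sub>n(L) : \<HH>\<^sub>k \<rightarrow> \<HH>\<^sub>k\<^sub>-\<^sub>2\<^sub>n\<close>, a unitary map.\<close>

definition b_op ::
  "(complex \<Rightarrow> 'a::ab_group_add \<Rightarrow> 'a) \<Rightarrow> (int \<Rightarrow> 'a set) \<Rightarrow> (int \<Rightarrow> 'a \<Rightarrow> 'a \<Rightarrow> complex)
    \<Rightarrow> ('a \<times> 'a) set \<Rightarrow> real \<Rightarrow> int \<Rightarrow> int \<Rightarrow> ('a \<times> 'a) set"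
  where "b_op smul H ip L z1 n k = scale_op H ip (b_base smul (H 0) L z1 n) k (k - 2 * n)"

end

theory Submission
  imports Defs
begin

text \<open>
  The point \<open>z\<^sub>1\<close> lies in the resolvent set, so \<open>L - z\<^sub>1\<close> has an everywhere defined symmetric inverse
  \<open>B\<close>.  The ranges of the powers \<open>B\<^sup>p\<close> are dense in every \<open>\<HH>\<^sub>n\<close> with \<open>n \<le> p\<close>, and on them
  \<open>\<langle>f, B\<^sup>p x\<rangle>\<^sub>n = \<langle>f, B\<^sup>p\<^sup>-\<^sup>n x\<rangle>\<^sub>0\<close>, because \<open>b\<^sub>n(L)\<close> is the square of the operator that
  defines the inner product of \<open>\<HH>\<^sub>n\<close>.  Testing against these vectors turns every statement about
  the maps \<open>b\<^sub>j(L)\<close> into one about \<open>B\<close> in \<open>\<HH>\<^sub>0\<close>; neither the spectral theorem nor the uniqueness of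
  square roots is needed.

  For the projections, \<open>\<langle>P\<^sub>0 (L - z\<^sub>1) f, g\<rangle>\<^sub>0 = \<langle>f, P\<^sub>1 g\<rangle>\<^sub>1 = \<langle>P\<^sub>1 f, g\<rangle>\<^sub>1 = \<langle>(L - z\<^sub>1) P\<^sub>2 f, g\<rangle>\<^sub>0\<close>
  for \<open>f\<close> in \<open>\<HH>\<^sub>2\<close> and \<open>g\<close> in \<open>\<HH>\<^sub>1\<close>, so \<open>P\<^sub>0\<close> commutes with \<open>B\<close>, and all the projections agree with
  \<open>P\<^sub>0\<close> on the ranges of high powers of \<open>B\<close>.
\<close>

section \<open>Sequences and orthogonality in Hilbert spaces on a carrier\<close>

text \<open>Membership of every term is part of the notion, whereas \<open>limitin\<close> asks for
  it only eventually. In exchange, convergence becomes a statement about a null sequence of reals,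
  open to the usual limit rules.\<close>

definition hconverges ::
  "'a::ab_group_add set \<Rightarrow> ('a \<Rightarrow> 'a \<Rightarrow> complex) \<Rightarrow> (nat \<Rightarrow> 'a) \<Rightarrow> 'a \<Rightarrow> bool"
  where "hconverges H ip X f \<longleftrightarrow>
    f \<in> H \<and> (\<forall>i. X i \<in> H) \<and> (\<lambda>i. hnorm ip (X i - f)) \<longlonglongrightarrow> 0"

definition hdense :: "'a::ab_group_add set \<Rightarrow> ('a \<Rightarrow> 'a \<Rightarrow> complex) \<Rightarrow> 'a set \<Rightarrow> bool"
  where "hdense H ip S \<longleftrightarrow> (\<forall>f\<in>H. \<exists>X. (\<forall>i. X i \<in> S) \<and> hconverges H ip X f)"

context hilbert_space
begin

lemma zero_mem [simp]: "0 \<in> H"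
  using subspace_carrier by (rule subspace_0)

lemma add_mem: "x \<in> H \<Longrightarrow> y \<in> H \<Longrightarrow> x + y \<in> H"
  using subspace_carrier by (rule subspace_add)

lemma diff_mem: "x \<in> H \<Longrightarrow> y \<in> H \<Longrightarrow> x - y \<in> H"
  using subspace_carrier by (rule subspace_diff)

lemma scale_mem: "x \<in> H \<Longrightarrow> smul c x \<in> H"
  using subspace_carrier by (rule subspace_scale)

lemma minus_mem: "x \<in> H \<Longrightarrow> - x \<in> H"
  using subspace_carrier by (rule subspace_neg)

lemmas mem_intros = zero_mem add_mem diff_mem scale_mem minus_mem

lemma ip_add_right: "x \<in> H \<Longrightarrow> y \<in> H \<Longrightarrow> z \<in> H \<Longrightarrow> ip z (x + y) = ip z x + ip z y"
  using ip_commute[of "x + y" z] ip_commute[of x z] ip_commute[of y z] ip_add_left[of x y z]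
  by (simp add: add_mem)

lemma ip_scale_right: "x \<in> H \<Longrightarrow> y \<in> H \<Longrightarrow> ip x (smul c y) = cnj c * ip x y"
  using ip_commute[of "smul c y" x] ip_commute[of y x] ip_scale_left[of y x c]
  by (simp add: scale_mem)

lemma ip_minus_left: "x \<in> H \<Longrightarrow> y \<in> H \<Longrightarrow> ip (- x) y = - ip x y"
  using ip_scale_left[of x y "-1"] by simp

lemma ip_minus_right: "x \<in> H \<Longrightarrow> y \<in> H \<Longrightarrow> ip x (- y) = - ip x y"
  using ip_scale_right[of x y "-1"] by simp

lemma ip_diff_left: "x \<in> H \<Longrightarrow> y \<in> H \<Longrightarrow> z \<in> H \<Longrightarrow> ip (x - y) z = ip x z - ip y z"
  using ip_add_left[of x "- y" z] by (simp add: ip_minus_left minus_mem)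

lemma ip_diff_right: "x \<in> H \<Longrightarrow> y \<in> H \<Longrightarrow> z \<in> H \<Longrightarrow> ip z (x - y) = ip z x - ip z y"
  using ip_add_right[of x "- y" z] by (simp add: ip_minus_right minus_mem)

lemma ip_zero_left [simp]: "x \<in> H \<Longrightarrow> ip 0 x = 0"
  using ip_diff_left[of 0 0 x] by simp

lemma ip_zero_right [simp]: "x \<in> H \<Longrightarrow> ip x 0 = 0"
  using ip_diff_right[of 0 0 x] by simp

lemmas ip_simps = ip_add_left ip_add_right ip_diff_left ip_diff_right ip_scale_left ip_scale_right

lemma Re_ip_self_nonneg: "x \<in> H \<Longrightarrow> 0 \<le> Re (ip x x)"
  by (cases "x = 0") (auto intro: less_imp_le ip_pos)

lemma Im_ip_self: "x \<in> H \<Longrightarrow> Im (ip x x) = 0"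
  using ip_commute[of x x] by (simp add: complex_eq_iff)

lemma ip_self_complex: "x \<in> H \<Longrightarrow> ip x x = complex_of_real (Re (ip x x))"
  by (simp add: complex_eq_iff Im_ip_self)

lemma ip_self_eq_0: "x \<in> H \<Longrightarrow> ip x x = 0 \<longleftrightarrow> x = 0"
  using ip_pos[of x] by fastforce

lemma hnorm_nonneg: "x \<in> H \<Longrightarrow> 0 \<le> hnorm ip x"
  by (simp add: hnorm_def Re_ip_self_nonneg)

lemma hnorm_power2: "x \<in> H \<Longrightarrow> (hnorm ip x)\<^sup>2 = Re (ip x x)"
  by (simp add: hnorm_def Re_ip_self_nonneg)

lemma hnorm_eq_0: "x \<in> H \<Longrightarrow> hnorm ip x = 0 \<longleftrightarrow> x = 0"
  using ip_pos[of x] by (cases "x = 0") (auto simp: hnorm_def)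

lemma Cauchy_Schwarz:
  assumes x: "x \<in> H" and y: "y \<in> H"
  shows "cmod (ip x y) \<le> hnorm ip x * hnorm ip y"
proof (cases "y = 0")
  case False
  define a where "a = ip x y"
  define r where "r = Re (ip y y)"
  have r: "r > 0" and yy: "ip y y = complex_of_real r"
    using False y by (auto simp: r_def ip_pos intro: ip_self_complex)
  have yx: "ip y x = cnj a"
    using ip_commute[OF x y] by (simp add: a_def)
  \<comment> \<open>This is \<open>r\<close> times the component of \<open>x\<close> orthogonal to
    \<open>y\<close>. The factor \<open>r\<close> avoids a division, and nonnegativity of the
    squared norm is the claim.\<close>
  let ?z = "smul (complex_of_real r) x - smul a y"
  define R where "R = Re (ip x x)"
  have xx: "ip x x = complex_of_real R"
    using x unfolding R_def by (rule ip_self_complex)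
  have xy: "ip x y = a" by (simp add: a_def)
  have "ip ?z ?z = complex_of_real r * (complex_of_real r * complex_of_real R - a * cnj a)"
    using x y by (simp add: ip_simps mem_intros yx yy xx xy)
  also have "\<dots> = complex_of_real (r * (r * R - (cmod a)\<^sup>2))"
    by (simp only: complex_norm_square of_real_mult of_real_diff)
  finally have "Re (ip ?z ?z) = r * (r * R - (cmod a)\<^sup>2)"
    by (simp only: Re_complex_of_real)
  moreover have "0 \<le> Re (ip ?z ?z)"
    by (intro Re_ip_self_nonneg diff_mem scale_mem x y)
  ultimately have "(cmod a)\<^sup>2 \<le> r * R"
    using r by (simp add: zero_le_mult_iff)
  also have "\<dots> = (hnorm ip x * hnorm ip y)\<^sup>2"
    using hnorm_power2[OF x] hnorm_power2[OF y] by (simp add: power_mult_distrib r_def R_def)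
  finally have "cmod a \<le> hnorm ip x * hnorm ip y"
    by (rule power2_le_imp_le) (intro mult_nonneg_nonneg hnorm_nonneg x y)
  then show ?thesis by (simp only: xy)
qed (use x y in \<open>simp add: hnorm_def\<close>)

lemma hnorm_triangle:
  assumes x: "x \<in> H" and y: "y \<in> H"
  shows "hnorm ip (x + y) \<le> hnorm ip x + hnorm ip y"
proof (rule power2_le_imp_le)
  have "Re (ip x y) \<le> hnorm ip x * hnorm ip y"
    using Cauchy_Schwarz[OF x y] complex_Re_le_cmod order_trans by blast
  moreover have "Re (ip y x) = Re (ip x y)"
    using ip_commute[OF x y] by simp
  ultimately show "(hnorm ip (x + y))\<^sup>2 \<le> (hnorm ip x + hnorm ip y)\<^sup>2"
    using x y by (simp add: hnorm_power2 add_mem ip_add_left ip_add_right power2_sum)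
qed (use x y in \<open>simp add: hnorm_nonneg\<close>)

lemma hnorm_minus: "x \<in> H \<Longrightarrow> hnorm ip (- x) = hnorm ip x"
  by (simp add: hnorm_def ip_minus_left ip_minus_right minus_mem)

lemma hnorm_diff_commute: "x \<in> H \<Longrightarrow> y \<in> H \<Longrightarrow> hnorm ip (x - y) = hnorm ip (y - x)"
  using hnorm_minus[of "x - y"] by (simp add: diff_mem)

lemma hnorm_scale:
  assumes x: "x \<in> H"
  shows "hnorm ip (smul c x) = cmod c * hnorm ip x"
proof -
  define R where "R = Re (ip x x)"
  have xx: "ip x x = complex_of_real R"
    using x unfolding R_def by (rule ip_self_complex)
  have "ip (smul c x) (smul c x) = c * cnj c * ip x x"
    using x by (simp add: ip_simps scale_mem)
  also have "\<dots> = complex_of_real ((cmod c)\<^sup>2 * R)"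
    by (simp only: complex_norm_square of_real_mult xx)
  finally show ?thesis
    by (simp add: hnorm_def real_sqrt_mult R_def)
qed

lemma Metric_space_hdist: "Metric_space H (hdist H ip)"
proof
  fix x y z assume xyz: "x \<in> H" "y \<in> H" "z \<in> H"
  show "hdist H ip x z \<le> hdist H ip x y + hdist H ip y z"
    using hnorm_triangle[of "x - y" "y - z"] xyz by (simp add: hdist_def diff_mem)
qed (auto simp: hdist_def hnorm_nonneg hnorm_diff_commute diff_mem hnorm_eq_0)

interpretation metric: Metric_space H "hdist H ip"
  by (rule Metric_space_hdist)

abbreviation converges :: "(nat \<Rightarrow> 'a) \<Rightarrow> 'a \<Rightarrow> bool"
  where "converges \<equiv> hconverges H ip"

lemmas converges_def = hconverges_def[of H ip]

lemma converges_mem: "converges X f \<Longrightarrow> f \<in> H" "converges X f \<Longrightarrow> X i \<in> H"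
  by (auto simp: converges_def)

lemma limitin_iff_converges:
  "(\<And>i. X i \<in> H) \<Longrightarrow> limitin (htop H ip) X f sequentially \<longleftrightarrow> converges X f"
  by (auto simp: metric.limitin_metric_dist_null converges_def hdist_def)

lemma closure_of_iff:
  "f \<in> htop H ip closure_of S \<longleftrightarrow> (\<exists>X. (\<forall>i. X i \<in> S) \<and> converges X f)"
  (is "?l \<longleftrightarrow> ?r")
proof
  assume ?l
  then obtain X where X: "range X \<subseteq> S \<inter> H" "limitin (htop H ip) X f sequentially"
    by (auto simp: metric.closure_of_sequentially)
  then have "converges X f"
    by (subst limitin_iff_converges[symmetric]) auto
  then show ?r using X by auto
next
  assume ?r
  then obtain X where X: "\<And>i. X i \<in> S" "converges X f" by blast
  then have "limitin (htop H ip) X f sequentially"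
    using limitin_iff_converges[of X f] by (auto simp: converges_def)
  moreover have "range X \<subseteq> S \<inter> H" "f \<in> H"
    using X by (auto simp: converges_def)
  ultimately show ?l
    by (auto simp: metric.closure_of_sequentially)
qed

lemma closure_of_eq_carrier_iff: "htop H ip closure_of S = H \<longleftrightarrow> hdense H ip S"
  by (auto simp: hdense_def closure_of_iff converges_mem set_eq_iff)

lemma converges_bound:
  assumes "f \<in> H" "\<And>i. X i \<in> H" "\<And>i. hnorm ip (X i - f) \<le> b i" "b \<longlonglongrightarrow> 0"
  shows "converges X f"
proof -
  have "norm (hnorm ip (X i - f)) \<le> b i" for i
    using assms hnorm_nonneg[of "X i - f"] by (simp add: diff_mem)
  then have "(\<lambda>i. hnorm ip (X i - f)) \<longlonglongrightarrow> 0"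
    by (intro Lim_null_comparison[OF always_eventually assms(4)]) blast
  then show ?thesis using assms by (simp add: converges_def)
qed

lemma converges_const: "f \<in> H \<Longrightarrow> converges (\<lambda>_. f) f"
  by (simp add: converges_def hnorm_def)

lemma converges_add:
  assumes X: "converges X f" and Y: "converges Y g"
  shows "converges (\<lambda>i. X i + Y i) (f + g)"
proof -
  have m: "f \<in> H" "g \<in> H" "\<And>i. X i \<in> H" "\<And>i. Y i \<in> H"
    using X Y by (auto simp: converges_def)
  have "(\<lambda>i. hnorm ip (X i - f) + hnorm ip (Y i - g)) \<longlonglongrightarrow> 0"
    using tendsto_add[of "\<lambda>i. hnorm ip (X i - f)" 0 _ "\<lambda>i. hnorm ip (Y i - g)" 0] X Y
    by (simp add: converges_def)
  moreover have "hnorm ip (X i + Y i - (f + g)) \<le> hnorm ip (X i - f) + hnorm ip (Y i - g)" for i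
    using hnorm_triangle[of "X i - f" "Y i - g"] m by (simp add: diff_mem algebra_simps)
  ultimately show ?thesis
    using m by (intro converges_bound) (auto intro: add_mem)
qed

lemma converges_scale:
  assumes X: "converges X f"
  shows "converges (\<lambda>i. smul c (X i)) (smul c f)"
proof -
  have m: "f \<in> H" "\<And>i. X i \<in> H"
    using X by (auto simp: converges_def)
  have "hnorm ip (smul c (X i) - smul c f) = cmod c * hnorm ip (X i - f)" for i
    using m hnorm_scale[of "X i - f" c] by (simp add: diff_mem scale_right_diff_distrib)
  moreover have "(\<lambda>i. cmod c * hnorm ip (X i - f)) \<longlonglongrightarrow> 0"
    using X by (auto simp: converges_def intro: tendsto_mult_right_zero)
  ultimately show ?thesis using m by (simp add: converges_def scale_mem)
qed

lemma converges_diff: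
  assumes X: "converges X f" and Y: "converges Y g"
  shows "converges (\<lambda>i. X i - Y i) (f - g)"
proof -
  have "converges (\<lambda>i. X i + smul (-1) (Y i)) (f + smul (-1) g)"
    by (intro converges_add converges_scale X Y)
  moreover have "x + smul (-1) y = x - y" for x y :: 'a
    by simp
  ultimately show ?thesis by (simp only:)
qed

lemma converges_unique:
  assumes "converges X f" "converges X g"
  shows "f = g"
proof -
  have "converges (\<lambda>_. 0) (f - g)"
    using converges_diff[OF assms] by simp
  then have "f - g \<in> H" "hnorm ip (- (f - g)) = 0"
    by (simp_all add: converges_def LIMSEQ_const_iff)
  then have "f - g = 0"
    by (metis hnorm_minus hnorm_eq_0)
  then show ?thesis by simp
qed

lemma converges_ip:
  assumes X: "converges X f" and Y: "converges Y g"
  shows "(\<lambda>i. ip (X i) (Y i)) \<longlonglongrightarrow> ip f g"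
proof -
  have m: "f \<in> H" "g \<in> H" "\<And>i. X i \<in> H" "\<And>i. Y i \<in> H"
    using X Y by (auto simp: converges_def)
  let ?x = "\<lambda>i. hnorm ip (X i - f)" and ?y = "\<lambda>i. hnorm ip (Y i - g)"
  have x: "?x \<longlonglongrightarrow> 0" and y: "?y \<longlonglongrightarrow> 0"
    using X Y by (auto simp: converges_def)
  have "(\<lambda>i. ?x i * ?y i + ?x i * hnorm ip g + hnorm ip f * ?y i) \<longlonglongrightarrow> 0 * 0 + 0 * hnorm ip g + hnorm ip f * 0"
    by (intro tendsto_intros x y)
  then have lim: "(\<lambda>i. ?x i * ?y i + ?x i * hnorm ip g + hnorm ip f * ?y i) \<longlonglongrightarrow> 0"
    by simp
  have "norm (ip (X i) (Y i) - ip f g) \<le> ?x i * ?y i + ?x i * hnorm ip g + hnorm ip f * ?y i" for i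
  proof -
    have "ip (X i) (Y i) - ip f g
        = ip (X i - f) (Y i - g) + ip (X i - f) g + ip f (Y i - g)"
      using m by (simp add: ip_simps diff_mem)
    moreover have "norm (ip (X i - f) (Y i - g) + ip (X i - f) g + ip f (Y i - g))
        \<le> ?x i * ?y i + ?x i * hnorm ip g + hnorm ip f * ?y i"
      by (intro norm_triangle_mono Cauchy_Schwarz diff_mem m)
    ultimately show ?thesis by (simp only:)
  qed
  then have "(\<lambda>i. ip (X i) (Y i) - ip f g) \<longlonglongrightarrow> 0"
    by (intro Lim_null_comparison[OF _ lim] always_eventually) auto
  then show ?thesis by (simp add: LIM_zero_iff)
qed

lemma converges_ip_left: "converges X f \<Longrightarrow> g \<in> H \<Longrightarrow> (\<lambda>i. ip (X i) g) \<longlonglongrightarrow> ip f g"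
  using converges_ip converges_const by blast

lemma converges_ip_right: "converges X f \<Longrightarrow> g \<in> H \<Longrightarrow> (\<lambda>i. ip g (X i)) \<longlonglongrightarrow> ip g f"
  using converges_ip converges_const by blast

lemma Cauchy_converges:
  assumes X: "\<And>i. X i \<in> H"
    and Cauchy: "\<And>e. e > 0 \<Longrightarrow> \<exists>N. \<forall>i\<ge>N. \<forall>j\<ge>N. hnorm ip (X i - X j) < e"
  shows "\<exists>f. converges X f"
proof -
  have "metric.MCauchy X"
    unfolding metric.MCauchy_def using X Cauchy by (fastforce simp: hdist_def)
  then obtain f where "limitin (htop H ip) X f sequentially"
    using complete metric.mcomplete_def by blast
  then show ?thesis using limitin_iff_converges X by blast
qed

lemma converges_imp_Cauchy:
  assumes X: "converges X f" and e: "e > 0"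
  shows "\<exists>N. \<forall>i\<ge>N. \<forall>j\<ge>N. hnorm ip (X i - X j) < e"
proof -
  have m: "f \<in> H" "\<And>i. X i \<in> H"
    using X by (auto simp: converges_def)
  have "(\<lambda>i. hnorm ip (X i - f)) \<longlonglongrightarrow> 0"
    using X by (simp add: converges_def)
  then have "\<forall>\<^sub>F i in sequentially. hnorm ip (X i - f) < e / 2"
    using e by (intro order_tendstoD) auto
  then obtain N where N: "\<And>i. i \<ge> N \<Longrightarrow> hnorm ip (X i - f) < e / 2"
    by (auto simp: eventually_sequentially)
  have "hnorm ip (X i - X j) < e" if "i \<ge> N" "j \<ge> N" for i j
    using hnorm_triangle[of "X i - f" "f - X j"] hnorm_diff_commute[of f "X j"] N[OF that(1)] N[OF that(2)] m
    by (simp add: diff_mem)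
  then show ?thesis by blast
qed

text \<open>No diagonal sequence is chosen by hand: idempotence of the topological closure provides
  it.\<close>

lemma converges_diagonal:
  assumes "S \<subseteq> H" "converges Y f" "\<And>i. \<exists>X. (\<forall>j. X j \<in> S) \<and> converges X (Y i)"
  shows "\<exists>X. (\<forall>j. X j \<in> S) \<and> converges X f"
proof -
  have "Y i \<in> htop H ip closure_of S" for i
    using assms(3) by (auto simp: closure_of_iff)
  then have "f \<in> htop H ip closure_of (htop H ip closure_of S)"
    using assms(2) closure_of_iff by blast
  then show ?thesis
    by (simp add: closure_of_iff)
qed

text \<open>The minimizing sequence of the distance from \<open>f\<close> to \<open>M\<close> is Cauchy by the parallelogram law,
  and the difference of \<open>f\<close> and its limit is orthogonal to \<open>M\<close>.\<close>

lemma dense_if_trivial_orth_complement: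
  assumes M: "subspace M" "M \<subseteq> H"
    and triv: "\<And>g. g \<in> H \<Longrightarrow> (\<And>m. m \<in> M \<Longrightarrow> ip g m = 0) \<Longrightarrow> g = 0"
  shows "hdense H ip M"
  unfolding hdense_def
proof
  fix f assume f: "f \<in> H"
  define D where "D = (\<lambda>m. (hnorm ip (f - m))\<^sup>2) ` M"
  define d where "d = Inf D"
  have D: "D \<noteq> {}" "bdd_below D"
    using subspace_0[OF M(1)] by (auto simp: D_def bdd_below_def intro!: exI[of _ 0])
  have d_le: "d \<le> (hnorm ip (f - m))\<^sup>2" if "m \<in> M" for m
    unfolding d_def using D that by (auto intro!: cInf_lower simp: D_def)
  have "\<exists>m\<in>M. (hnorm ip (f - m))\<^sup>2 < d + inverse (real (Suc i))" for i
  proof -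
    have "d < d + inverse (real (Suc i))" by simp
    then obtain t where "t \<in> D" "t < d + inverse (real (Suc i))"
      using cInf_lessD[OF D(1)] unfolding d_def by blast
    then show ?thesis by (auto simp: D_def)
  qed
  then obtain X where X: "\<And>i. X i \<in> M"
    and Xd: "\<And>i. (hnorm ip (f - X i))\<^sup>2 < d + inverse (real (Suc i))"
    by metis
  have XH: "X i \<in> H" for i using X M by auto
  have parallelogram: "(hnorm ip (X i - X j))\<^sup>2
      = 2 * (hnorm ip (f - X i))\<^sup>2 + 2 * (hnorm ip (f - X j))\<^sup>2
        - 4 * (hnorm ip (f - smul (1/2) (X i + X j)))\<^sup>2" for i j
    using XH[of i] XH[of j] f ip_commute[of f "X i"] ip_commute[of f "X j"] ip_commute[of "X i" "X j"]
    by (simp add: hnorm_power2 mem_intros ip_simps) (simp add: field_simps)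
  have bound: "(hnorm ip (X i - X j))\<^sup>2 < 4 * inverse (real (Suc N))" if "i \<ge> N" "j \<ge> N" for i j N
  proof -
    have "inverse (real (Suc i)) \<le> inverse (real (Suc N))"
         "inverse (real (Suc j)) \<le> inverse (real (Suc N))"
      using that by (auto intro!: le_imp_inverse_le)
    \<comment> \<open>The midpoint lies in \<open>M\<close>, so its squared distance from
      \<open>f\<close> is at least \<open>d\<close>. In the parallelogram identity this bound
      cancels the \<open>4 * d\<close> coming from the two near-minimal terms.\<close>
    moreover have "smul (1/2) (X i + X j) \<in> M"
      by (intro subspace_scale[OF M(1)] subspace_add[OF M(1)] X)
    ultimately show ?thesis
      using parallelogram[of i j] Xd[of i] Xd[of j] d_le[of "smul (1/2) (X i + X j)"] by linarith
  qed
  obtain p where p: "converges X p"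
  proof (atomize_elim, rule Cauchy_converges[OF XH])
    fix e :: real assume e: "e > 0"
    then obtain N where N: "inverse (real (Suc N)) < e\<^sup>2 / 4"
      using reals_Archimedean[of "e\<^sup>2 / 4"] by auto
    have "hnorm ip (X i - X j) < e" if "i \<ge> N" "j \<ge> N" for i j
      using bound[OF that] N e
      by (intro power2_less_imp_less[of _ e]) (auto simp del: of_nat_Suc)
    then show "\<exists>N. \<forall>i\<ge>N. \<forall>j\<ge>N. hnorm ip (X i - X j) < e" by blast
  qed
  have pH: "p \<in> H" using p by (simp add: converges_def)
  define w where "w = f - p"
  have wH: "w \<in> H" using f pH by (simp add: w_def diff_mem)
  have conv_w: "converges (\<lambda>i. f - X i) w"
    unfolding w_def using p f by (intro converges_diff converges_const)
  have norm_lim: "(\<lambda>i. (hnorm ip (f - X i - v))\<^sup>2) \<longlonglongrightarrow> (hnorm ip (w - v))\<^sup>2" if v: "v \<in> H" for v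
  proof -
    have "converges (\<lambda>i. f - X i - v) (w - v)"
      using conv_w v by (intro converges_diff converges_const)
    then have "(\<lambda>i. Re (ip (f - X i - v) (f - X i - v))) \<longlonglongrightarrow> Re (ip (w - v) (w - v))"
      by (intro tendsto_Re converges_ip)
    then show ?thesis using v wH f XH by (simp add: hnorm_power2 diff_mem)
  qed
  \<comment> \<open>\<open>M\<close> need not be closed, so \<open>p\<close> may lie outside it.
    Minimality of \<open>w\<close> is therefore obtained as a limit of the inequalities for the
    vectors \<open>X i + v\<close>, which do lie in \<open>M\<close>.\<close>
  have w_ge: "d \<le> (hnorm ip (w - v))\<^sup>2" if v: "v \<in> M" for v
  proof (rule LIMSEQ_le_const[OF norm_lim])
    show "v \<in> H" using v M by auto
    have "d \<le> (hnorm ip (f - X i - v))\<^sup>2" for i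
      using d_le[of "X i + v"] X v subspace_add[OF M(1)] by (simp add: diff_diff_eq)
    then show "\<exists>N. \<forall>i\<ge>N. d \<le> (hnorm ip (f - X i - v))\<^sup>2" by blast
  qed
  have w_le: "(hnorm ip w)\<^sup>2 \<le> d"
  proof (rule LIMSEQ_le)
    show "(\<lambda>i. (hnorm ip (f - X i))\<^sup>2) \<longlonglongrightarrow> (hnorm ip w)\<^sup>2"
      using norm_lim[of 0] by simp
    show "(\<lambda>i. d + inverse (real (Suc i))) \<longlonglongrightarrow> d"
      using tendsto_add[OF tendsto_const LIMSEQ_inverse_real_of_nat, of d] by simp
    show "\<exists>N. \<forall>i\<ge>N. (hnorm ip (f - X i))\<^sup>2 \<le> d + inverse (real (Suc i))"
      using Xd less_imp_le by blast
  qed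
  have "ip w v = 0" if v: "v \<in> M" for v
  proof -
    have vH: "v \<in> H" using v M by auto
    define a where "a = ip w v"
    define r where "r = Re (ip v v)"
    \<comment> \<open>Moving \<open>w\<close> by \<open>t * a\<close> along \<open>v\<close> must
      not shorten it. This choice gives \<open>2 * t - t\<^sup>2 * r = t * (1 + t) > 0\<close>;
      unlike the optimal \<open>1 / r\<close> it also makes sense for \<open>v = 0\<close>.\<close>
    define t where "t = 1 / (1 + r)"
    have r: "r \<ge> 0" "ip v v = complex_of_real r"
      using vH by (auto simp: r_def Re_ip_self_nonneg intro: ip_self_complex)
    have vw: "ip v w = cnj a" using ip_commute[OF wH vH] by (simp add: a_def)
    have wv: "ip w v = a" by (simp add: a_def)
    let ?u = "smul (complex_of_real t * a) v"
    have "(hnorm ip w)\<^sup>2 \<le> (hnorm ip (w - ?u))\<^sup>2"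
      using w_ge[of ?u] w_le v subspace_scale[OF M(1)] by force
    moreover have "ip (w - ?u) (w - ?u)
        = ip w w - complex_of_real (2 * t - t\<^sup>2 * r) * (a * cnj a)"
      using wH vH
      by (simp add: ip_simps mem_intros wv vw r(2)) (simp add: algebra_simps power2_eq_square)
    then have "ip (w - ?u) (w - ?u)
        = ip w w - complex_of_real ((2 * t - t\<^sup>2 * r) * (cmod a)\<^sup>2)"
      by (simp only: complex_norm_square of_real_mult)
    then have "Re (ip (w - ?u) (w - ?u)) = Re (ip w w) - (2 * t - t\<^sup>2 * r) * (cmod a)\<^sup>2"
      by (simp only: minus_complex.sel Re_complex_of_real)
    ultimately have "(2 * t - t\<^sup>2 * r) * (cmod a)\<^sup>2 \<le> 0"
      using wH vH by (simp add: hnorm_power2 mem_intros)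
    moreover have "2 * t - t\<^sup>2 * r > 0"
    proof -
      have "t * (1 + r) = 1" and t: "t > 0" using r by (auto simp: t_def)
      then have "2 * t - t\<^sup>2 * r = t * (1 + t)"
        by algebra
      then show ?thesis using t by simp
    qed
    ultimately have "(cmod a)\<^sup>2 \<le> 0"
      by (simp add: mult_le_0_iff)
    then show ?thesis by (simp add: a_def)
  qed
  then have "w = 0" using triv wH by blast
  then have "converges X f" using p by (simp add: w_def)
  then show "\<exists>X. (\<forall>i. X i \<in> M) \<and> converges X f" using X by blast
qed

text \<open>The difference of the two vectors is a limit of elements of \<open>S\<close>, to all of
  which it is orthogonal; hence it is orthogonal to itself.\<close>

lemma hdense_ip_eq:
  assumes S: "hdense H ip S" and "u \<in> H" "v \<in> H" and eq: "\<And>s. s \<in> S \<Longrightarrow> ip u s = ip v s"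
    and SH: "S \<subseteq> H"
  shows "u = v"
proof -
  have w: "u - v \<in> H" using assms by (simp add: diff_mem)
  then obtain X where X: "\<And>i. X i \<in> S" "converges X (u - v)"
    using S by (auto simp: hdense_def)
  have "ip (u - v) (X i) = 0" for i
    using X(1)[of i] eq SH assms(2,3) by (auto simp: ip_diff_left)
  then have "ip (u - v) (u - v) = 0"
    using converges_ip_right[OF X(2) w] by (simp add: LIMSEQ_const_iff)
  then show ?thesis using w ip_self_eq_0 by auto
qed

end

section \<open>Operators as graphs, and a range criterion for self-adjointness\<close>

definition op_apply :: "('a \<times> 'a) set \<Rightarrow> 'a \<Rightarrow> 'a"
  where "op_apply T f = (THE g. (f, g) \<in> T)"

lemma op_apply_eq: "single_valued T \<Longrightarrow> (f, g) \<in> T \<Longrightarrow> op_apply T f = g"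
  unfolding op_apply_def by (rule the_equality) (auto dest: single_valuedD)

context vector_space
begin

text \<open>\<open>linear_operator\<close> refers to subspaces for an ad hoc scaling of pairs. This
  scaling has to be recognized as a module before the notion can be unfolded.\<close>

lemma subspace_pairs_iff:
  "module.subspace (\<lambda>c (f, g). (scale c f, scale c g)) A \<longleftrightarrow>
    (0, 0) \<in> A \<and> (\<forall>f g f' g'. (f, g) \<in> A \<longrightarrow> (f', g') \<in> A \<longrightarrow> (f + f', g + g') \<in> A) \<and>
    (\<forall>c f g. (f, g) \<in> A \<longrightarrow> (scale c f, scale c g) \<in> A)"
proof -
  interpret pair: module "\<lambda>c (f, g). (scale c f, scale c g)"
    by unfold_locales (auto simp: scale_right_distrib scale_left_distrib)
  show ?thesis
    by (auto simp: pair.subspace_def zero_prod_def Ball_def)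
qed

end

context hilbert_space
begin

lemma linear_operatorI:
  assumes "A \<subseteq> K \<times> K" "single_valued A" "(0, 0) \<in> A"
    and "\<And>f g f' g'. (f, g) \<in> A \<Longrightarrow> (f', g') \<in> A \<Longrightarrow> (f + f', g + g') \<in> A"
    and "\<And>c f g. (f, g) \<in> A \<Longrightarrow> (smul c f, smul c g) \<in> A"
  shows "linear_operator smul K A"
  using assms by (auto simp: linear_operator_def subspace_pairs_iff)

lemma
  assumes "linear_operator smul K A"
  shows linear_operator_subset: "A \<subseteq> K \<times> K"
    and linear_operator_single_valued: "single_valued A"
    and linear_operator_0: "(0, 0) \<in> A"
    and linear_operator_add: "(f, g) \<in> A \<Longrightarrow> (f', g') \<in> A \<Longrightarrow> (f + f', g + g') \<in> A"
    and linear_operator_scale: "(f, g) \<in> A \<Longrightarrow> (smul c f, smul c g) \<in> A"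
  using assms by (auto simp: linear_operator_def subspace_pairs_iff)

lemma linear_operator_diff:
  assumes "linear_operator smul K A" "(f, g) \<in> A" "(f', g') \<in> A"
  shows "(f - f', g - g') \<in> A"
  using linear_operator_add[OF assms(1,2) linear_operator_scale[OF assms(1,3), of "-1"]] by simp

text \<open>Given a pair \<open>(g, h)\<close> of the adjoint, surjectivity of \<open>T - c\<close>
  yields a pair of \<open>T\<close> with the same image under the shift. Because \<open>c\<close> is
  real and \<open>T\<close> symmetric, the two first components differ by a vector orthogonal to the
  range of \<open>T - c\<close>, which is all of \<open>H\<close>; so they coincide.\<close>

lemma self_adjointI:
  assumes T: "linear_operator smul H T" and dense: "hdense H ip (Domain T)"
    and sym: "\<And>f g f' g'. (f, g) \<in> T \<Longrightarrow> (f', g') \<in> T \<Longrightarrow> ip g f' = ip f g'"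
    and surj: "\<And>h. h \<in> H \<Longrightarrow> \<exists>f g. (f, g) \<in> T \<and> g - smul (complex_of_real c) f = h"
  shows "self_adjoint smul H ip T"
proof -
  note TH = linear_operator_subset[OF T]
  have "op_adjoint H ip T \<subseteq> T"
  proof clarify
    fix g h assume "(g, h) \<in> op_adjoint H ip T"
    then have gh: "g \<in> H" "h \<in> H" and adj: "\<And>f k. (f, k) \<in> T \<Longrightarrow> ip k g = ip f h"
      by (auto simp: op_adjoint_def)
    obtain f0 g0 where T0: "(f0, g0) \<in> T"
      and eq: "g0 - smul (complex_of_real c) f0 = h - smul (complex_of_real c) g"
      using surj[of "h - smul (complex_of_real c) g"] gh by (auto simp: mem_intros)
    have mem0: "f0 \<in> H" "g0 \<in> H" using T0 TH by auto
    have "ip (g - f0) s = 0" if "s \<in> H" for s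
    proof -
      obtain f k where fk: "(f, k) \<in> T" "k - smul (complex_of_real c) f = s"
        using surj \<open>s \<in> H\<close> by blast
      have mem: "f \<in> H" "k \<in> H" using fk TH by auto
      have "ip f (h - smul (complex_of_real c) g) = ip f (g0 - smul (complex_of_real c) f0)"
        using eq by simp
      then have "ip s g = ip s f0"
        unfolding fk(2)[symmetric] using gh mem0 mem adj[OF fk(1)] sym[OF fk(1) T0]
        by (simp add: ip_simps mem_intros)
      then show ?thesis
        using ip_commute[of s g] ip_commute[of s f0] gh mem0 \<open>s \<in> H\<close> by (simp add: ip_diff_left)
    qed
    then have "g = f0"
      using ip_self_eq_0[of "g - f0"] gh mem0 by (simp add: diff_mem)
    with eq T0 show "(g, h) \<in> T" by simp
  qed
  moreover have "T \<subseteq> op_adjoint H ip T"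
    using TH sym by (fastforce simp: op_adjoint_def)
  ultimately show ?thesis
    using T dense by (auto simp: self_adjoint_def closure_of_eq_carrier_iff)
qed

lemma symmetric_of_self_adjoint:
  assumes "self_adjoint smul H ip T" "(f, g) \<in> T" "(f', g') \<in> T"
  shows "ip g f' = ip f g'"
proof -
  have "(f', g') \<in> op_adjoint H ip T" using assms by (simp add: self_adjoint_def)
  then show ?thesis using assms(2) by (auto simp: op_adjoint_def)
qed

section \<open>Orthogonal projections\<close>

context
  fixes M P
  assumes P: "is_orth_projection smul H ip M P"
begin

lemma proj_linear_operator: "linear_operator smul H P"
  using P by (simp add: is_orth_projection_def)

lemma proj_iff: "(f, g) \<in> P \<longleftrightarrow> f \<in> H \<and> op_apply P f = g"
proof
  assume "(f, g) \<in> P"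
  then show "f \<in> H \<and> op_apply P f = g"
    using linear_operator_subset[OF proj_linear_operator]
      op_apply_eq[OF linear_operator_single_valued[OF proj_linear_operator]] by auto
next
  assume fg: "f \<in> H \<and> op_apply P f = g"
  then have "f \<in> Domain P" using P by (simp add: is_orth_projection_def)
  then obtain g' where "(f, g') \<in> P" by blast
  then show "(f, g) \<in> P"
    using fg op_apply_eq[OF linear_operator_single_valued[OF proj_linear_operator]] by auto
qed

lemma proj_in: "f \<in> H \<Longrightarrow> (f, op_apply P f) \<in> P"
  by (simp add: proj_iff)

lemma proj_mem: "f \<in> H \<Longrightarrow> op_apply P f \<in> H"
  using proj_in linear_operator_subset[OF proj_linear_operator] by blast

lemma proj_add: "f \<in> H \<Longrightarrow> g \<in> H \<Longrightarrow> op_apply P (f + g) = op_apply P f + op_apply P g"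
  using linear_operator_add[OF proj_linear_operator proj_in proj_in] by (auto simp: proj_iff)

lemma proj_scale: "f \<in> H \<Longrightarrow> op_apply P (smul c f) = smul c (op_apply P f)"
  using linear_operator_scale[OF proj_linear_operator proj_in] by (auto simp: proj_iff)

lemma proj_diff: "f \<in> H \<Longrightarrow> g \<in> H \<Longrightarrow> op_apply P (f - g) = op_apply P f - op_apply P g"
  using linear_operator_diff[OF proj_linear_operator proj_in proj_in] by (auto simp: proj_iff)

lemma proj_0: "op_apply P 0 = 0"
  using proj_diff[of 0 0] by simp

lemma proj_sym: "f \<in> H \<Longrightarrow> g \<in> H \<Longrightarrow> ip (op_apply P f) g = ip f (op_apply P g)"
proof -
  assume f: "f \<in> H" and g: "g \<in> H"
  have "(g, op_apply P g) \<in> op_adjoint H ip P"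
    using P proj_in[OF g] by (simp add: is_orth_projection_def)
  then show ?thesis using proj_in[OF f] by (auto simp: op_adjoint_def)
qed

lemma proj_idem: "f \<in> H \<Longrightarrow> op_apply P (op_apply P f) = op_apply P f"
proof -
  assume f: "f \<in> H"
  have "(f, op_apply P (op_apply P f)) \<in> P O P"
    using proj_in[OF f] proj_in[OF proj_mem[OF f]] by blast
  then have "(f, op_apply P (op_apply P f)) \<in> P"
    using P by (simp add: is_orth_projection_def)
  then show ?thesis by (simp add: proj_iff)
qed

lemma proj_range: "M = {f \<in> H. op_apply P f = f}"
proof -
  have "M = Range P" using P by (simp add: is_orth_projection_def)
  also have "\<dots> = {f \<in> H. op_apply P f = f}"
    using proj_iff proj_mem proj_idem by (auto simp: Range_iff)
  finally show ?thesis .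
qed

lemma orth_complement_proj: "orth_complement H ip M = {f \<in> H. op_apply P f = 0}"
proof (intro equalityI subsetI)
  fix f assume "f \<in> orth_complement H ip M"
  then have f: "f \<in> H" and "\<And>m. m \<in> M \<Longrightarrow> ip m f = 0"
    by (auto simp: orth_complement_def)
  then have "ip (op_apply P f) f = 0"
    using proj_range proj_mem proj_idem by blast
  then have "ip (op_apply P f) (op_apply P f) = 0"
    using f proj_sym[of "op_apply P f" f] by (simp add: proj_mem proj_idem)
  then show "f \<in> {f \<in> H. op_apply P f = 0}"
    using f by (simp add: ip_self_eq_0 proj_mem)
next
  fix f assume f: "f \<in> {f \<in> H. op_apply P f = 0}"
  have "ip m f = 0" if "m \<in> M" for m
    using that f proj_sym[of m f] by (auto simp: proj_range)
  then show "f \<in> orth_complement H ip M"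
    using f by (simp add: orth_complement_def)
qed

lemma hnorm_proj_le:
  assumes f: "f \<in> H"
  shows "hnorm ip (op_apply P f) \<le> hnorm ip f"
proof (cases "hnorm ip (op_apply P f) = 0")
  case True
  then show ?thesis using f by (simp add: hnorm_nonneg)
next
  case False
  have Pf: "op_apply P f \<in> H" using f by (rule proj_mem)
  have "(hnorm ip (op_apply P f))\<^sup>2 = Re (ip (op_apply P f) f)"
    using proj_sym[OF Pf f] f by (simp add: hnorm_power2 Pf proj_idem)
  also have "\<dots> \<le> hnorm ip (op_apply P f) * hnorm ip f"
    using Cauchy_Schwarz[OF Pf f] complex_Re_le_cmod order_trans by blast
  finally show ?thesis
    using False hnorm_nonneg[OF Pf] by (simp add: power2_eq_square)
qed

lemma converges_proj:
  assumes X: "converges X f"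
  shows "converges (\<lambda>i. op_apply P (X i)) (op_apply P f)"
proof (rule converges_bound)
  have m: "f \<in> H" "\<And>i. X i \<in> H"
    using X by (auto simp: converges_def)
  show "op_apply P f \<in> H" "op_apply P (X i) \<in> H" for i
    using m by (simp_all add: proj_mem)
  show "hnorm ip (op_apply P (X i) - op_apply P f) \<le> hnorm ip (X i - f)" for i
    using hnorm_proj_le[of "X i - f"] m by (simp add: proj_diff diff_mem)
  show "(\<lambda>i. hnorm ip (X i - f)) \<longlonglongrightarrow> 0"
    using X by (simp add: converges_def)
qed

text \<open>The kernel of \<open>P\<close> is thus also the range of an orthogonal projection, so
  whatever is shown for ranges of projections covers orthogonal complements as well.\<close>

lemma proj_complement:
  "is_orth_projection smul H ip (orth_complement H ip M) {(f, f - op_apply P f) | f. f \<in> H}"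
  (is "is_orth_projection smul H ip _ ?Q")
proof -
  have mem: "f - op_apply P f \<in> H" if "f \<in> H" for f
    using that by (simp add: diff_mem proj_mem)
  have idem: "op_apply P (f - op_apply P f) = 0" if "f \<in> H" for f
    using that by (simp add: proj_diff proj_mem proj_idem)
  have "linear_operator smul H ?Q"
    by (rule linear_operatorI)
      (auto simp: mem single_valued_def proj_0 proj_add proj_scale scale_right_diff_distrib
        intro: add_mem scale_mem)
  moreover have "Domain ?Q = H" by auto
  moreover have "?Q O ?Q = ?Q"
    using mem idem by (auto simp: relcomp_unfold)
  moreover have "op_adjoint H ip ?Q = ?Q"
  proof (intro equalityI subrelI)
    fix g h assume "(g, h) \<in> op_adjoint H ip ?Q"
    then have gh: "g \<in> H" "h \<in> H" and adj: "\<And>f. f \<in> H \<Longrightarrow> ip (f - op_apply P f) g = ip f h"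
      by (auto simp: op_adjoint_def)
    have "ip f (g - op_apply P g - h) = 0" if "f \<in> H" for f
      using adj[OF that] gh that by (simp add: ip_diff_left ip_diff_right proj_mem proj_sym mem)
    then have "ip (g - op_apply P g - h) (g - op_apply P g - h) = 0"
      by (simp add: gh mem diff_mem)
    then have "g - op_apply P g - h = 0"
      by (subst (asm) ip_self_eq_0) (simp_all add: gh mem diff_mem)
    then show "(g, h) \<in> ?Q" using gh by simp
  next
    fix g h assume "(g, h) \<in> ?Q"
    then show "(g, h) \<in> op_adjoint H ip ?Q"
      by (auto simp: op_adjoint_def mem ip_diff_left ip_diff_right proj_mem proj_sym)
  qed
  moreover have "Range ?Q = orth_complement H ip M"
    unfolding orth_complement_proj
  proof (intro equalityI subsetI)
    fix f assume "f \<in> {f \<in> H. op_apply P f = 0}"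
    then have "(f, f) \<in> ?Q" by simp
    then show "f \<in> Range ?Q" by blast
  qed (use mem idem in \<open>auto simp: Range_iff\<close>)
  ultimately show ?thesis by (simp add: is_orth_projection_def)
qed

section \<open>The range of a projection as a closed subspace and as a Hilbert space\<close>

lemma subspace_proj_range: "subspace M"
  by (rule subspaceI)
    (auto simp: proj_range proj_0 proj_add proj_scale intro: add_mem scale_mem)

lemma proj_range_subset: "M \<subseteq> H"
  by (auto simp: proj_range)

lemma converges_proj_range:
  assumes "\<And>i. X i \<in> M" "converges X f"
  shows "f \<in> M"
proof -
  have "op_apply P (X i) = X i" for i
    using assms(1)[of i] by (simp add: proj_range)
  then have "op_apply P f = f"
    using converges_unique converges_proj[OF assms(2)] assms(2) by simp
  then show ?thesis using assms(2) by (simp add: proj_range converges_def)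
qed

text \<open>The part of an operator in \<open>M\<close> is to be self-adjoint with respect to
  \<open>M\<close>, so \<open>M\<close> has to be a Hilbert space in its own right. Completeness is
  inherited because \<open>M\<close> is the fixed point set of the continuous map
  \<open>P\<close>.\<close>

lemma hilbert_space_proj_range: "hilbert_space smul M ip"
proof unfold_locales
  have M: "x \<in> H" if "x \<in> M" for x using that proj_range_subset by blast
  have MS: "Metric_space M (hdist M ip)"
  proof
    fix x y z assume "x \<in> M" "y \<in> M" "z \<in> M"
    then have "x \<in> H" "y \<in> H" "z \<in> H" by (simp_all add: M)
    then show "hdist M ip x z \<le> hdist M ip x y + hdist M ip y z"
      using hnorm_triangle[of "x - y" "y - z"] \<open>x \<in> M\<close> \<open>y \<in> M\<close> \<open>z \<in> M\<close>
      by (simp add: hdist_def diff_mem)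
  qed (auto simp: hdist_def hnorm_nonneg hnorm_diff_commute diff_mem hnorm_eq_0 M)
  interpret M: Metric_space M "hdist M ip" by (rule MS)
  show "M.mcomplete"
    unfolding M.mcomplete_def
  proof (intro allI impI)
    fix X assume "M.MCauchy X"
    then have X: "\<And>i. X i \<in> M"
      and "\<forall>e>0. \<exists>N. \<forall>i j. N \<le> i \<longrightarrow> N \<le> j \<longrightarrow> hdist M ip (X i) (X j) < e"
      by (auto simp: M.MCauchy_def)
    then have "\<exists>N. \<forall>i\<ge>N. \<forall>j\<ge>N. hnorm ip (X i - X j) < e" if "e > 0" for e
      using that by (simp add: hdist_def)
    then obtain f where f: "converges X f"
      using Cauchy_converges X M by blast
    then have "f \<in> M" using X by (rule converges_proj_range[rotated])
    then show "\<exists>f. limitin M.mtopology X f sequentially"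
      using f X by (intro exI[of _ f]) (simp add: M.limitin_metric_dist_null hdist_def converges_def)
  qed
qed (use subspace_proj_range proj_range_subset in
      \<open>auto simp: ip_add_left ip_scale_left ip_pos subset_iff intro: ip_commute\<close>)

lemma closed_subspace_proj_range: "closed_subspace smul H ip M"
proof -
  interpret metric: Metric_space H "hdist H ip"
    by (rule Metric_space_hdist)
  have "f \<in> M" if "range X \<subseteq> M" "limitin (htop H ip) X f sequentially" for X f
  proof (rule converges_proj_range)
    show "X i \<in> M" for i using that by auto
    then have "X i \<in> H" for i using proj_range_subset by auto
    then show "converges X f" using that limitin_iff_converges by blast
  qed
  then show ?thesis
    using subspace_proj_range proj_range_subset
    by (auto simp: closed_subspace_def metric.metric_closedin_iff_sequentially_closed)
qed

text \<open>By \<open>comm\<close>, splitting a vector of the domain along \<open>P\<close> stays in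
  the domain, and fixed points and kernel vectors of \<open>P\<close> are mapped to such vectors
  again. Symmetry is inherited by the part in \<open>M\<close>, and projecting a solution of
  \<open>(T - c) f = h\<close> solves the same equation inside \<open>M\<close>; so the criterion
  \<open>self_adjointI\<close> applies there with the same \<open>c\<close>.\<close>

lemma
  assumes T: "linear_operator smul H T" and dense: "hdense H ip (Domain T)"
    and sym: "\<And>f g f' g'. (f, g) \<in> T \<Longrightarrow> (f', g') \<in> T \<Longrightarrow> ip g f' = ip f g'"
    and surj: "\<And>h. h \<in> H \<Longrightarrow> \<exists>f g. (f, g) \<in> T \<and> g - smul (complex_of_real c) f = h"
    and comm: "\<And>f g. (f, g) \<in> T \<Longrightarrow> (op_apply P f, op_apply P g) \<in> T"
  shows reducing_subspace_proj_range: "reducing_subspace smul H ip T M"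
    and self_adjoint_part_proj_range: "self_adjoint smul M ip (part_in T M)"
proof -
  note TH = linear_operator_subset[OF T]
  note Tsv = linear_operator_single_valued[OF T]
  have invariant: "g \<in> M" if "(f, g) \<in> T" "f \<in> M" for f g
  proof -
    have "op_apply P f = f" using that by (simp add: proj_range)
    then have "(f, op_apply P g) \<in> T" using comm[OF that(1)] by simp
    then have "op_apply P g = g" using that Tsv by (auto dest: single_valuedD)
    then show ?thesis using that TH by (auto simp: proj_range)
  qed
  have invariant': "g \<in> orth_complement H ip M" if "(f, g) \<in> T" "f \<in> orth_complement H ip M" for f g
  proof -
    have "op_apply P f = 0" using that by (simp add: orth_complement_proj)
    then have "(0, op_apply P g) \<in> T" using comm[OF that(1)] by simp
    then have "op_apply P g = 0"
      using linear_operator_0[OF T] Tsv by (auto dest: single_valuedD)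
    then show ?thesis using that TH by (auto simp: orth_complement_proj)
  qed
  have "Domain T = {p + q | p q. p \<in> Domain T \<inter> M \<and> q \<in> Domain T \<inter> orth_complement H ip M}"
  proof (intro equalityI subsetI)
    fix f assume "f \<in> Domain T"
    then obtain g where fg: "(f, g) \<in> T" by blast
    then have f: "f \<in> H" using TH by auto
    have "op_apply P f \<in> Domain T \<inter> M"
      using comm[OF fg] f by (auto simp: proj_range proj_mem proj_idem)
    moreover have "f - op_apply P f \<in> Domain T \<inter> orth_complement H ip M"
      using linear_operator_diff[OF T fg comm[OF fg]] f
      by (auto simp: orth_complement_proj proj_mem proj_idem proj_diff diff_mem)
    moreover have "f = op_apply P f + (f - op_apply P f)" by simp
    ultimately show "f \<in> {p + q | p q. p \<in> Domain T \<inter> M \<and> q \<in> Domain T \<inter> orth_complement H ip M}"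
      by blast
  next
    fix f assume "f \<in> {p + q | p q. p \<in> Domain T \<inter> M \<and> q \<in> Domain T \<inter> orth_complement H ip M}"
    then show "f \<in> Domain T" using linear_operator_add[OF T] by blast
  qed
  then show "reducing_subspace smul H ip T M"
    using invariant invariant' closed_subspace_proj_range
    by (auto simp: reducing_subspace_def)
  interpret M: hilbert_space smul M ip by (rule hilbert_space_proj_range)
  show "self_adjoint smul M ip (part_in T M)"
  proof (rule M.self_adjointI)
    show "linear_operator smul M (part_in T M)"
    proof (rule linear_operatorI)
      show "part_in T M \<subseteq> M \<times> M" using invariant by (auto simp: part_in_def)
      show "single_valued (part_in T M)"
        using Tsv by (auto simp: part_in_def single_valued_def)
    qed (auto simp: part_in_def linear_operator_0[OF T] linear_operator_add[OF T]
           linear_operator_scale[OF T] intro: M.mem_intros)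
    show "hdense M ip (Domain (part_in T M))"
      unfolding hdense_def
    proof
      fix f assume f: "f \<in> M"
      then have "f \<in> H" "op_apply P f = f" by (auto simp: proj_range)
      then obtain X where X: "\<And>i. X i \<in> Domain T" "converges X f"
        using dense unfolding hdense_def by meson
      \<comment> \<open>Approximants from the domain of \<open>T\<close> may lie outside
        \<open>M\<close>. Their projections lie in \<open>M\<close>, remain in the domain by
        \<open>comm\<close>, and converge to \<open>P f = f\<close>.\<close>
      then have "converges (\<lambda>i. op_apply P (X i)) f"
        using converges_proj[OF X(2)] \<open>op_apply P f = f\<close> by simp
      moreover have "op_apply P (X i) \<in> Domain (part_in T M)" for i
      proof -
        obtain g where g: "(X i, g) \<in> T" using X(1) by blast
        then have "X i \<in> H" using TH by auto
        then have "op_apply P (X i) \<in> M" by (simp add: proj_range proj_mem proj_idem)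
        then show ?thesis using comm[OF g] by (auto simp: part_in_def)
      qed
      moreover have "Domain (part_in T M) \<subseteq> M" by (auto simp: part_in_def)
      ultimately have "(\<forall>i. op_apply P (X i) \<in> Domain (part_in T M)) \<and> 
          hconverges M ip (\<lambda>i. op_apply P (X i)) f"
        using f by (auto simp: hconverges_def)
      then show "\<exists>X. (\<forall>i. X i \<in> Domain (part_in T M)) \<and> hconverges M ip X f" by (intro exI[of _ "\<lambda>i. op_apply P (X i)"])
    qed
    show "ip g f' = ip f g'" if "(f, g) \<in> part_in T M" "(f', g') \<in> part_in T M" for f g f' g'
      using that sym by (auto simp: part_in_def)
    show "\<exists>f g. (f, g) \<in> part_in T M \<and> g - smul (complex_of_real c) f = h" if h: "h \<in> M" for h
    proof -
      have "h \<in> H" "op_apply P h = h" using h by (auto simp: proj_range)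
      then obtain f g where fg: "(f, g) \<in> T" "g - smul (complex_of_real c) f = h"
        using surj by blast
      have "f \<in> H" "g \<in> H" using fg TH by auto
      then have "op_apply P g - smul (complex_of_real c) (op_apply P f) = h"
        using fg(2) \<open>op_apply P h = h\<close> by (metis proj_diff proj_scale scale_mem)
      moreover have "(op_apply P f, op_apply P g) \<in> part_in T M"
        using comm[OF fg(1)] \<open>f \<in> H\<close> by (auto simp: part_in_def proj_range proj_mem proj_idem)
      ultimately show ?thesis by blast
    qed
  qed
qed

end

end

section \<open>The scale and the inverse of \<open>L - z1\<close>\<close>

locale operator_scale =
  fixes smul :: "complex \<Rightarrow> 'a::ab_group_add \<Rightarrow> 'a"
    and H :: "int \<Rightarrow> 'a set"
    and ip :: "int \<Rightarrow> 'a \<Rightarrow> 'a \<Rightarrow> complex"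
    and L :: "('a \<times> 'a) set"
    and z1 :: real
  assumes L_self_adjoint: "self_adjoint smul (H 0) (ip 0) L"
    and z1: "ereal z1 < (INF z\<in>spectrum smul (H 0) (ip 0) L. ereal (Re z))"
    and H_scale: "hilbert_scale smul L z1 H ip"

sublocale operator_scale \<subseteq> hilbert_space smul "H n" "ip n" for n
  using H_scale by (simp add: hilbert_scale_def)

context operator_scale
begin

abbreviation A :: "('a \<times> 'a) set"
  where "A \<equiv> op_shift smul L (complex_of_real z1)"

lemma A_iff: "(f, g) \<in> A \<longleftrightarrow> (f, g + smul (complex_of_real z1) f) \<in> L"
  by (force simp: op_shift_def)

lemma L_linear: "linear_operator smul (H 0) L"
  using L_self_adjoint by (simp add: self_adjoint_def)

lemma z1_in_resolvent_set: "complex_of_real z1 \<in> resolvent_set smul (H 0) (ip 0) L"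
proof (rule ccontr)
  assume "complex_of_real z1 \<notin> resolvent_set smul (H 0) (ip 0) L"
  then have "complex_of_real z1 \<in> spectrum smul (H 0) (ip 0) L"
    by (simp add: spectrum_def)
  then have "(INF z\<in>spectrum smul (H 0) (ip 0) L. ereal (Re z)) \<le> ereal (Re (complex_of_real z1))"
    by (rule INF_lower)
  with z1 show False by simp
qed

text \<open>The resolvent of \<open>L\<close> at \<open>z1\<close>, as a total function so that it
  can be iterated with \<open>^^\<close>. Its values outside \<open>H 0\<close> carry no
  meaning.\<close>

definition B :: "'a \<Rightarrow> 'a"
  where "B = op_apply (A\<inverse>)"

lemma A_eq_B: "(f, h) \<in> A \<longleftrightarrow> h \<in> H 0 \<and> f = B h"
proof -
  have sv: "single_valued (A\<inverse>)" and R: "Range A = H 0"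
    using z1_in_resolvent_set by (auto simp: resolvent_set_def)
  show ?thesis
  proof
    assume "(f, h) \<in> A"
    then show "h \<in> H 0 \<and> f = B h"
      using op_apply_eq[OF sv, of h f] R by (auto simp: B_def)
  next
    assume h: "h \<in> H 0 \<and> f = B h"
    then obtain f' where "(f', h) \<in> A" using R by blast
    then show "(f, h) \<in> A"
      using op_apply_eq[OF sv, of h f'] h by (auto simp: B_def)
  qed
qed

lemma B_in_L: "h \<in> H 0 \<Longrightarrow> (B h, h + smul (complex_of_real z1) (B h)) \<in> L"
  using A_eq_B[of "B h" h] by (simp add: A_iff)

lemma B_mem: "h \<in> H 0 \<Longrightarrow> B h \<in> H 0"
  using B_in_L linear_operator_subset[OF L_linear] by blast

lemma B_add: "x \<in> H 0 \<Longrightarrow> y \<in> H 0 \<Longrightarrow> B (x + y) = B x + B y"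
  using linear_operator_add[OF L_linear B_in_L B_in_L, of x y] A_eq_B[of "B x + B y" "x + y"]
  by (simp add: A_iff scale_right_distrib algebra_simps)

lemma B_scale: "x \<in> H 0 \<Longrightarrow> B (smul c x) = smul c (B x)"
  using linear_operator_scale[OF L_linear B_in_L, of x c] A_eq_B[of "smul c (B x)" "smul c x"]
  by (simp add: A_iff scale_mem scale_right_distrib mult.commute)

lemma B_sym: "x \<in> H 0 \<Longrightarrow> y \<in> H 0 \<Longrightarrow> ip 0 (B x) y = ip 0 x (B y)"
  using symmetric_of_self_adjoint[OF L_self_adjoint B_in_L B_in_L, of x y]
  by (simp add: ip_add_left ip_add_right ip_scale_left ip_scale_right scale_mem B_mem)

lemma B_eq_0: "x \<in> H 0 \<Longrightarrow> B x = 0 \<Longrightarrow> x = 0"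
  using B_in_L[of x] linear_operator_0[OF L_linear] linear_operator_single_valued[OF L_linear]
  by (auto dest: single_valuedD)

lemma funpow_B_mem: "x \<in> H 0 \<Longrightarrow> (B ^^ n) x \<in> H 0"
  by (induction n) (auto intro: B_mem)

lemma funpow_B_add: "x \<in> H 0 \<Longrightarrow> y \<in> H 0 \<Longrightarrow> (B ^^ n) (x + y) = (B ^^ n) x + (B ^^ n) y"
  by (induction n) (auto simp: B_add funpow_B_mem)

lemma funpow_B_scale: "x \<in> H 0 \<Longrightarrow> (B ^^ n) (smul c x) = smul c ((B ^^ n) x)"
  by (induction n) (auto simp: B_scale funpow_B_mem)

lemma funpow_B_diff: "x \<in> H 0 \<Longrightarrow> y \<in> H 0 \<Longrightarrow> (B ^^ n) (x - y) = (B ^^ n) x - (B ^^ n) y"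
  using funpow_B_add[of "x - y" y n] by (simp add: diff_mem)

lemma funpow_B_sym: "x \<in> H 0 \<Longrightarrow> y \<in> H 0 \<Longrightarrow> ip 0 ((B ^^ n) x) y = ip 0 x ((B ^^ n) y)"
proof (induction n arbitrary: y)
  case (Suc n)
  then have "ip 0 ((B ^^ Suc n) x) y = ip 0 x ((B ^^ n) (B y))"
    by (simp add: B_sym B_mem funpow_B_mem)
  then show ?case by (simp add: funpow_swap1)
qed simp

lemma funpow_B_eq_0: "x \<in> H 0 \<Longrightarrow> (B ^^ n) x = 0 \<Longrightarrow> x = 0"
  by (induction n) (auto dest: B_eq_0[OF funpow_B_mem])

section \<open>Integer powers\<close>

abbreviation b :: "int \<Rightarrow> ('a \<times> 'a) set"
  where "b \<equiv> b_base smul (H 0) L z1"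

text \<open>The conjunct \<open>f \<in> H 0\<close> is what \<open>Id_on\<close> contributes in
  \<open>op_power\<close>. It matters for \<open>n = 0\<close>, where the relational power is the
  identity of the whole type.\<close>

lemma relpow_A: "(f, h) \<in> A ^^ n \<and> f \<in> H 0 \<longleftrightarrow> h \<in> H 0 \<and> f = (B ^^ n) h"
proof (induction n arbitrary: h)
  case (Suc n)
  have "(f, h) \<in> A ^^ Suc n \<and> f \<in> H 0 \<longleftrightarrow> (\<exists>k. ((f, k) \<in> A ^^ n \<and> f \<in> H 0) \<and> (k, h) \<in> A)"
    by auto
  also have "\<dots> \<longleftrightarrow> (\<exists>k. (k \<in> H 0 \<and> f = (B ^^ n) k) \<and> h \<in> H 0 \<and> k = B h)"
    by (simp only: Suc.IH A_eq_B)
  also have "\<dots> \<longleftrightarrow> h \<in> H 0 \<and> f = (B ^^ Suc n) h"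
    by (auto simp: B_mem funpow_swap1)
  finally show ?case .
qed auto

lemma relpow_converse_A: "(f, h) \<in> (A\<inverse>) ^^ n \<and> f \<in> H 0 \<longleftrightarrow> f \<in> H 0 \<and> h = (B ^^ n) f"
proof (induction n arbitrary: h)
  case (Suc n)
  have "(f, h) \<in> (A\<inverse>) ^^ Suc n \<and> f \<in> H 0
      \<longleftrightarrow> (\<exists>k. ((f, k) \<in> (A\<inverse>) ^^ n \<and> f \<in> H 0) \<and> (h, k) \<in> A)"
    by auto
  also have "\<dots> \<longleftrightarrow> (\<exists>k. (f \<in> H 0 \<and> k = (B ^^ n) f) \<and> k \<in> H 0 \<and> h = B k)"
    by (simp only: Suc.IH A_eq_B)
  also have "\<dots> \<longleftrightarrow> f \<in> H 0 \<and> h = (B ^^ Suc n) f"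
    by (auto simp: funpow_B_mem)
  finally show ?case .
qed auto

lemma b_nonneg: "0 \<le> j \<Longrightarrow> (f, h) \<in> b j \<longleftrightarrow> h \<in> H 0 \<and> f = (B ^^ nat j) h"
  using relpow_A[of f h "nat j"] by (auto simp: b_base_def op_power_def)

lemma b_neg: "j < 0 \<Longrightarrow> (f, h) \<in> b j \<longleftrightarrow> f \<in> H 0 \<and> h = (B ^^ nat (- j)) f"
  using relpow_converse_A[of f h "nat (- j)"] by (auto simp: b_base_def op_power_def)

lemma b_subset: "(f, h) \<in> b j \<Longrightarrow> f \<in> H 0 \<and> h \<in> H 0"
  by (cases "0 \<le> j") (auto simp: b_nonneg b_neg funpow_B_mem)

text \<open>Writing \<open>j\<close> as a difference of natural exponents lets the maps
  \<open>U j k\<close> be handled later without distinguishing the sign of \<open>j\<close>.\<close>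

lemma b_core:
  assumes x: "x \<in> H 0" and j: "int p - int q = j"
  shows "((B ^^ p) x, (B ^^ q) x) \<in> b j"
proof (cases "0 \<le> j")
  case True
  then have "p = nat j + q" using j by simp
  then show ?thesis
    using True x by (simp add: b_nonneg funpow_B_mem funpow_add)
next
  case False
  then have "q = nat (- j) + p" using j by simp
  then show ?thesis
    using False x by (simp add: b_neg funpow_B_mem funpow_add)
qed

text \<open>A power of \<open>B\<close> moves across the inner product by symmetry. The exponents
  differ in the direction opposite to \<open>b_core\<close>, because the power leaves one argument
  and is added to the other.\<close>

lemma b_ip_core:
  assumes fh: "(f, h) \<in> b j" and x: "x \<in> H 0" and j: "int q - int p = j"
  shows "ip 0 f ((B ^^ p) x) = ip 0 h ((B ^^ q) x)"
proof (cases "0 \<le> j")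
  case True
  then have "q = nat j + p" using j by simp
  then show ?thesis
    using fh True x by (simp add: b_nonneg funpow_B_mem funpow_add funpow_B_sym)
next
  case False
  then have "p = nat (- j) + q" using j by simp
  then show ?thesis
    using fh False x by (simp add: b_neg funpow_B_mem funpow_add funpow_B_sym)
qed

section \<open>The common core\<close>

lemma H_Suc: "H (n + 1) \<subseteq> H n"
  and embedding_Suc:
    "continuous_map (htop (H (n + 1)) (ip (n + 1))) (htop (H n) (ip n)) (\<lambda>f. f)"
  using H_scale unfolding hilbert_scale_def by simp_all

lemma converges_Suc:
  assumes X: "converges (n + 1) X f"
  shows "converges n X f"
proof -
  have "\<And>i. X i \<in> H (n + 1)"
    using X by (simp add: converges_def)
  then have "limitin (htop (H n) (ip n)) X f sequentially"
    using continuous_map_limit[OF embedding_Suc] X limitin_iff_converges[of X "n + 1" f]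
    by (fastforce simp: comp_def)
  moreover have "\<And>i. X i \<in> H n"
    using \<open>\<And>i. X i \<in> H (n + 1)\<close> H_Suc by blast
  ultimately show ?thesis
    using limitin_iff_converges by blast
qed

lemma
  assumes "m \<le> n"
  shows H_mono: "H n \<subseteq> H m"
    and converges_mono: "converges n X f \<Longrightarrow> converges m X f"
proof -
  have "H n \<subseteq> H m \<and> (converges n X f \<longrightarrow> converges m X f)"
    using assms
  proof (induction n rule: int_ge_induct)
    case (step n)
    then show ?case using H_Suc[of n] converges_Suc[of n X f] by blast
  qed simp
  then show "H n \<subseteq> H m" "converges n X f \<Longrightarrow> converges m X f" by auto
qed

lemma H_mono': "f \<in> H n \<Longrightarrow> m \<le> n \<Longrightarrow> f \<in> H m"
  using H_mono by blast

lemma scale_sqrt: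
  obtains S where "self_adjoint smul (H 0) (ip 0) S" "S O S = b n"
    "0 \<le> n \<Longrightarrow> H n = Domain S" "n < 0 \<Longrightarrow> hdense (H n) (ip n) (H 0)"
    "\<And>f f' g g'. (f, f') \<in> S \<Longrightarrow> (g, g') \<in> S \<Longrightarrow> ip n f g = ip 0 f' g'"
proof -
  have "\<exists>S. is_positive_sqrt smul (H 0) (ip 0) (b n) S \<and>
      (if 0 \<le> n then H n = Domain S
       else H 0 \<subseteq> H n \<and> htop (H n) (ip n) closure_of (H 0) = H n) \<and>
      (\<forall>(f, f')\<in>S. \<forall>(g, g')\<in>S. ip n f g = ip 0 f' g')"
    using H_scale unfolding hilbert_scale_def by (elim conjE allE)
  then obtain S where S: "is_positive_sqrt smul (H 0) (ip 0) (b n) S"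
    "if 0 \<le> n then H n = Domain S
       else H 0 \<subseteq> H n \<and> htop (H n) (ip n) closure_of (H 0) = H n"
    "\<forall>(f, f')\<in>S. \<forall>(g, g')\<in>S. ip n f g = ip 0 f' g'"
    by (elim exE conjE)
  have "self_adjoint smul (H 0) (ip 0) S" "S O S = b n"
    using S(1) by (simp_all add: is_positive_sqrt_def)
  moreover have "H n = Domain S" if "0 \<le> n"
    using S(2) that by simp
  moreover have "hdense (H n) (ip n) (H 0)" if "n < 0"
    using S(2) that by (simp flip: closure_of_eq_carrier_iff)
  moreover have "ip n f g = ip 0 f' g'" if "(f, f') \<in> S" "(g, g') \<in> S" for f f' g g'
    using S(3) that by fast
  ultimately show ?thesis by (rule that)
qed

text \<open>Let \<open>S\<close> be the root of \<open>b n\<close> supplied by the scale. Its square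
  sends \<open>(B ^^ p) x\<close> to \<open>(B ^^ q) x\<close>, through some intermediate
  \<open>k\<close>. Hence \<open>(B ^^ p) x\<close> lies in the domain of \<open>S\<close>, and the
  inner product of level \<open>n\<close> equals that of \<open>S f\<close> and \<open>k\<close> in
  \<open>H 0\<close>, which symmetry of \<open>S\<close> turns into that of \<open>f\<close> and
  \<open>(B ^^ q) x\<close>.\<close>

lemma
  assumes x: "x \<in> H 0" and p: "n \<le> int p"
  shows core_mem: "(B ^^ p) x \<in> H n"
    and ip_core: "\<And>f q. f \<in> H n \<Longrightarrow> f \<in> H 0 \<Longrightarrow> int p - int q = n \<Longrightarrow>
      ip n f ((B ^^ p) x) = ip 0 f ((B ^^ q) x)"
proof -
  obtain S where S: "self_adjoint smul (H 0) (ip 0) S" "S O S = b n"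
    and dom: "0 \<le> n \<Longrightarrow> H n = Domain S"
    and ipS: "\<And>f f' g g'. (f, f') \<in> S \<Longrightarrow> (g, g') \<in> S \<Longrightarrow> ip n f g = ip 0 f' g'"
    using scale_sqrt[of n] by metis
  show "(B ^^ p) x \<in> H n"
  proof (cases "0 \<le> n")
    case True
    have "((B ^^ p) x, (B ^^ (p - nat n)) x) \<in> S O S"
      unfolding S(2) using True p x by (intro b_core) auto
    then show ?thesis using dom True by auto
  next
    case False
    then show ?thesis using funpow_B_mem[OF x] by (intro H_mono'[of _ 0 n]) auto
  qed
  fix f q
  assume f: "f \<in> H n" "f \<in> H 0" and q: "int p - int q = n"
  have "((B ^^ p) x, (B ^^ q) x) \<in> S O S"
    unfolding S(2) using x q by (rule b_core)
  then obtain k where k: "((B ^^ p) x, k) \<in> S" "(k, (B ^^ q) x) \<in> S" by blast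
  have "f \<in> Domain S"
  proof (cases "0 \<le> n")
    case False
    \<comment> \<open>For negative \<open>n\<close> the square of \<open>S\<close> is a power of
      \<open>B\<close> and is defined on all of \<open>H 0\<close>, hence so is
      \<open>S\<close>.\<close>
    then have "(f, (B ^^ nat (- n)) f) \<in> S O S"
      unfolding S(2) using f by (simp add: b_neg)
    then show ?thesis by blast
  qed (use dom f in auto)
  then obtain f' where f': "(f, f') \<in> S" by blast
  have "ip n f ((B ^^ p) x) = ip 0 f' k" using f' k(1) by (rule ipS)
  also have "\<dots> = ip 0 f ((B ^^ q) x)"
    using S(1) f' k(2) by (rule symmetric_of_self_adjoint)
  finally show "ip n f ((B ^^ p) x) = ip 0 f ((B ^^ q) x)" .
qed

lemma core_subset: "n \<le> int p \<Longrightarrow> (B ^^ p) ` H 0 \<subseteq> H n"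
  using core_mem by blast

lemma subspace_core: "subspace ((B ^^ p) ` H 0)"
proof (rule subspaceI)
  show "0 \<in> (B ^^ p) ` H 0"
    using funpow_B_diff[of 0 0 p] by (intro image_eqI[of _ _ 0]) auto
  show "x + y \<in> (B ^^ p) ` H 0" if "x \<in> (B ^^ p) ` H 0" "y \<in> (B ^^ p) ` H 0" for x y
    using that add_mem[of _ 0] by (auto simp flip: funpow_B_add)
  show "smul c x \<in> (B ^^ p) ` H 0" if "x \<in> (B ^^ p) ` H 0" for c x
    using that scale_mem[of _ 0] by (auto simp flip: funpow_B_scale)
qed

text \<open>If \<open>g\<close> is orthogonal to the core in \<open>H n\<close>, then by
  \<open>ip_core\<close> a power of \<open>B\<close> applied to \<open>g\<close> is orthogonal to
  all of \<open>H 0\<close>; injectivity of \<open>B\<close> gives \<open>g = 0\<close>.\<close>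

lemma hdense_core_nonneg:
  assumes n: "0 \<le> n" "n \<le> int p"
  shows "hdense (H n) (ip n) ((B ^^ p) ` H 0)"
proof (rule dense_if_trivial_orth_complement[OF subspace_core core_subset[OF n(2)]])
  fix g assume g: "g \<in> H n" and orth: "\<And>m. m \<in> (B ^^ p) ` H 0 \<Longrightarrow> ip n g m = 0"
  have g0: "g \<in> H 0" using g n(1) by (rule H_mono')
  let ?h = "(B ^^ (p - nat n)) g"
  have "ip 0 ?h x = 0" if x: "x \<in> H 0" for x
  proof -
    have "ip 0 ?h x = ip 0 g ((B ^^ (p - nat n)) x)"
      using g0 x by (rule funpow_B_sym)
    also have "\<dots> = ip n g ((B ^^ p) x)"
      using ip_core[OF x n(2) g g0, of "p - nat n"] n by simp
    finally show ?thesis using orth x by simp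
  qed
  then have "ip 0 ?h ?h = 0"
    using funpow_B_mem[OF g0] by simp
  then have "?h = 0"
    using ip_self_eq_0[of ?h 0] funpow_B_mem[OF g0] by simp
  with g0 show "g = 0" by (rule funpow_B_eq_0)
qed

text \<open>For negative \<open>n\<close> two approximations are chained: \<open>H 0\<close> is
  dense in \<open>H n\<close>, the core is dense in \<open>H 0\<close>, and the embedding of
  \<open>H 0\<close> into \<open>H n\<close> is continuous.\<close>

lemma hdense_core:
  assumes n: "n \<le> int p"
  shows "hdense (H n) (ip n) ((B ^^ p) ` H 0)"
proof (cases "0 \<le> n")
  case True
  then show ?thesis using n by (rule hdense_core_nonneg)
next
  case False
  then have dense0: "hdense (H n) (ip n) (H 0)"
    using scale_sqrt[of n] by (metis linorder_not_le)
  show ?thesis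
    unfolding hdense_def
  proof
    fix f assume "f \<in> H n"
    then obtain Y where Y: "\<And>i. Y i \<in> H 0" "converges n Y f"
      using dense0 unfolding hdense_def by meson
    have "\<exists>X. (\<forall>j. X j \<in> (B ^^ p) ` H 0) \<and> converges n X (Y i)" for i
    proof -
      have "hdense (H 0) (ip 0) ((B ^^ p) ` H 0)"
        by (rule hdense_core_nonneg) auto
      then obtain X where X: "\<And>j. X j \<in> (B ^^ p) ` H 0" "converges 0 X (Y i)"
        using Y(1) unfolding hdense_def by meson
      moreover have "converges n X (Y i)"
        using converges_mono[OF _ X(2)] False by simp
      ultimately show ?thesis by blast
    qed
    then show "\<exists>X. (\<forall>i. X i \<in> (B ^^ p) ` H 0) \<and> converges n X f"
      by (rule converges_diagonal[OF core_subset[OF n] Y(2)])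
  qed
qed

end

context operator_scale
begin

section \<open>The unitary maps between the spaces of the scale\<close>

text \<open>The map \<open>b\<^sub>j(L) : \<HH>\<^sub>k \<rightarrow> \<HH>\<^sub>k\<^sub>-\<^sub>2\<^sub>j\<close> in weak form, tested against the common core; in this form
  no limits are involved.\<close>

definition U :: "int \<Rightarrow> int \<Rightarrow> ('a \<times> 'a) set"
  where "U j k = {(f, h) \<in> H k \<times> H (k - 2 * j). \<forall>p q x.
    k \<le> int p \<longrightarrow> k - 2 * j \<le> int q \<longrightarrow> int p - int q = j \<longrightarrow> x \<in> H 0 \<longrightarrow>
      ip k f ((B ^^ p) x) = ip (k - 2 * j) h ((B ^^ q) x)}"

lemma U_I:
  assumes "f \<in> H k" "h \<in> H (k - 2 * j)"
    and "\<And>p q x. k \<le> int p \<Longrightarrow> k - 2 * j \<le> int q \<Longrightarrow> int p - int q = j \<Longrightarrow> x \<in> H 0 \<Longrightarrow>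
      ip k f ((B ^^ p) x) = ip (k - 2 * j) h ((B ^^ q) x)"
  shows "(f, h) \<in> U j k"
  using assms by (simp add: U_def)

lemma U_mem: "(f, h) \<in> U j k \<Longrightarrow> f \<in> H k" "(f, h) \<in> U j k \<Longrightarrow> h \<in> H (k - 2 * j)"
  by (auto simp: U_def)

lemma U_ip:
  assumes "(f, h) \<in> U j k" "k \<le> int p" "k - 2 * j \<le> int q" "int p - int q = j" "x \<in> H 0"
  shows "ip k f ((B ^^ p) x) = ip (k - 2 * j) h ((B ^^ q) x)"
  using assms unfolding U_def by blast

text \<open>Ensures that the test condition in \<open>U\<close> is never vacuous.\<close>

lemma ex_core_exponents:
  obtains p q where "k \<le> int p" "k - 2 * j \<le> int q" "int p - int q = j"
proof -
  show ?thesis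
    by (rule that[of "nat (\<bar>k\<bar> + 2 * \<bar>j\<bar> + j)" "nat (\<bar>k\<bar> + 2 * \<bar>j\<bar>)"]) linarith+
qed

text \<open>The test condition is symmetric once \<open>p\<close> and \<open>q\<close> trade places.
  Injectivity and surjectivity thus follow from single-valuedness and totality.\<close>

lemma U_converse: "(f, h) \<in> U j k \<longleftrightarrow> (h, f) \<in> U (- j) (k - 2 * j)"
proof -
  have *: "(h, f) \<in> U (- j) (k - 2 * j)" if "(f, h) \<in> U j k" for f h j k
    by (rule U_I) (use that U_ip[OF that] in \<open>auto dest: U_mem\<close>)
  show ?thesis using *[of f h j k] *[of h f "- j" "k - 2 * j"] by auto
qed

text \<open>By \<open>ip_core\<close> both sides become inner products in \<open>H 0\<close>, with
  the exponents \<open>p - k\<close> and \<open>q - (k - 2 * j)\<close>. The second exceeds the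
  first by \<open>j\<close>, as \<open>b_ip_core\<close> requires.\<close>

lemma b_subset_U:
  assumes fh: "(f, h) \<in> b j" and f: "f \<in> H k" and h: "h \<in> H (k - 2 * j)"
  shows "(f, h) \<in> U j k"
proof (rule U_I[OF f h])
  fix p q x assume pq: "k \<le> int p" "k - 2 * j \<le> int q" "int p - int q = j" and x: "x \<in> H 0"
  have f0: "f \<in> H 0" and h0: "h \<in> H 0" using b_subset[OF fh] by auto
  have "ip k f ((B ^^ p) x) = ip 0 f ((B ^^ nat (int p - k)) x)"
    using pq f f0 by (intro ip_core x) auto
  also have "\<dots> = ip 0 h ((B ^^ nat (int q - (k - 2 * j))) x)"
    using pq by (intro b_ip_core[OF fh x]) auto
  also have "\<dots> = ip (k - 2 * j) h ((B ^^ q) x)"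
    using pq h h0 by (intro ip_core[symmetric] x) auto
  finally show "ip k f ((B ^^ p) x) = ip (k - 2 * j) h ((B ^^ q) x)" .
qed

lemma core_in_U:
  assumes "k \<le> int p" "k - 2 * j \<le> int q" "int p - int q = j" "x \<in> H 0"
  shows "((B ^^ p) x, (B ^^ q) x) \<in> U j k"
  using assms by (intro b_subset_U b_core core_mem)

lemma U_closed:
  assumes FG: "\<And>i. (F i, G i) \<in> U j k" and F: "converges k F f" and G: "converges (k - 2 * j) G h"
  shows "(f, h) \<in> U j k"
proof (rule U_I)
  show "f \<in> H k" "h \<in> H (k - 2 * j)"
    using F G by (simp_all add: converges_def)
  fix p q x assume pq: "k \<le> int p" "k - 2 * j \<le> int q" "int p - int q = j" and x: "x \<in> H 0"
  have "(\<lambda>i. ip k (F i) ((B ^^ p) x)) \<longlonglongrightarrow> ip k f ((B ^^ p) x)"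
    using F core_mem[OF x pq(1)] by (rule converges_ip_left)
  moreover have "(\<lambda>i. ip (k - 2 * j) (G i) ((B ^^ q) x)) \<longlonglongrightarrow> ip (k - 2 * j) h ((B ^^ q) x)"
    using G core_mem[OF x pq(2)] by (rule converges_ip_left)
  ultimately show "ip k f ((B ^^ p) x) = ip (k - 2 * j) h ((B ^^ q) x)"
    using LIMSEQ_unique by (simp add: U_ip[OF FG pq x])
qed

lemma U_unique:
  assumes "(f, h) \<in> U j k" "(f, h') \<in> U j k"
  shows "h = h'"
proof -
  obtain p q where pq: "k \<le> int p" "k - 2 * j \<le> int q" "int p - int q = j"
    by (rule ex_core_exponents)
  show ?thesis
    by (rule hdense_ip_eq[OF hdense_core[OF pq(2)] _ _ _ core_subset[OF pq(2)]])
      (use assms U_ip[OF assms(1) pq] U_ip[OF assms(2) pq] in \<open>auto dest: U_mem\<close>)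
qed

lemma U_unique': "(f, h) \<in> U j k \<Longrightarrow> (f', h) \<in> U j k \<Longrightarrow> f = f'"
  using U_unique[of h f "- j" "k - 2 * j" f'] U_converse by blast

text \<open>Testing a pair of core vectors against the same \<open>x\<close> shows that the map is
  isometric on the core. It therefore carries Cauchy sequences to Cauchy sequences, and completeness
  of the target space gives the limit.\<close>

lemma U_transfer_converges:
  assumes pq: "k \<le> int p" "k - 2 * j \<le> int q" "int p - int q = j"
    and X: "\<And>i. X i \<in> H 0" "converges k (\<lambda>i. (B ^^ p) (X i)) f"
  shows "\<exists>h. converges (k - 2 * j) (\<lambda>i. (B ^^ q) (X i)) h \<and> (f, h) \<in> U j k"
proof -
  have isometric: "hnorm (ip (k - 2 * j)) ((B ^^ q) x) = hnorm (ip k) ((B ^^ p) x)" if "x \<in> H 0" for x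
    using U_ip[OF core_in_U[OF pq that] pq that] by (simp add: hnorm_def)
  have "\<exists>N. \<forall>i\<ge>N. \<forall>i'\<ge>N. hnorm (ip (k - 2 * j)) ((B ^^ q) (X i) - (B ^^ q) (X i')) < e"
    if "e > 0" for e
    using converges_imp_Cauchy[OF X(2) that]
    by (simp add: funpow_B_diff[symmetric] X(1) isometric diff_mem)
  then obtain h where h: "converges (k - 2 * j) (\<lambda>i. (B ^^ q) (X i)) h"
    using Cauchy_converges[of "\<lambda>i. (B ^^ q) (X i)" "k - 2 * j"] core_mem[OF X(1) pq(2)] by blast
  moreover have "(f, h) \<in> U j k"
    using core_in_U[OF pq X(1)] X(2) h by (rule U_closed)
  ultimately show ?thesis by blast
qed

text \<open>One sequence \<open>X\<close> in \<open>H 0\<close> approximates both the argument and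
  the value, so identities checked on the core pass to limits on both sides at once.\<close>

lemma U_approx:
  assumes pq: "k \<le> int p" "k - 2 * j \<le> int q" "int p - int q = j" and f: "f \<in> H k"
  obtains X h where "\<And>i. X i \<in> H 0" "converges k (\<lambda>i. (B ^^ p) (X i)) f"
    "converges (k - 2 * j) (\<lambda>i. (B ^^ q) (X i)) h" "(f, h) \<in> U j k"
proof -
  obtain Y where Y: "\<And>i. Y i \<in> (B ^^ p) ` H 0" "converges k Y f"
    using hdense_core[OF pq(1)] f unfolding hdense_def by meson
  then have "\<forall>i. \<exists>x. x \<in> H 0 \<and> Y i = (B ^^ p) x" by blast
  then obtain X where X: "\<And>i. X i \<in> H 0" "\<And>i. Y i = (B ^^ p) (X i)" by metis
  then have Xf: "converges k (\<lambda>i. (B ^^ p) (X i)) f" using Y(2) by (simp flip: X(2))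
  obtain h where "converges (k - 2 * j) (\<lambda>i. (B ^^ q) (X i)) h" "(f, h) \<in> U j k"
    using U_transfer_converges[of k p j q X f, OF pq X(1) Xf] by blast
  then show ?thesis by (rule that[OF X(1) Xf])
qed

lemma U_Domain: "f \<in> H k \<Longrightarrow> \<exists>h. (f, h) \<in> U j k"
  by (rule ex_core_exponents[of k j], erule (3) U_approx) blast

lemma U_Range: "h \<in> H (k - 2 * j) \<Longrightarrow> \<exists>f. (f, h) \<in> U j k"
  using U_Domain[of h "k - 2 * j" "- j"] U_converse by blast

lemma U_add: "(f, h) \<in> U j k \<Longrightarrow> (f', h') \<in> U j k \<Longrightarrow> (f + f', h + h') \<in> U j k"
  by (rule U_I) (auto simp: ip_add_left U_mem U_ip core_mem intro: add_mem U_mem)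

lemma U_scale: "(f, h) \<in> U j k \<Longrightarrow> (smul c f, smul c h) \<in> U j k"
  by (rule U_I) (auto simp: ip_scale_left U_mem U_ip core_mem intro: scale_mem U_mem)

lemma scale_op_iff:
  "(f, g) \<in> scale_op H ip T k m \<longleftrightarrow>
    (\<exists>X Y. (\<forall>i. (X i, Y i) \<in> T \<inter> H k \<times> H m) \<and> converges k X f \<and> converges m Y g)"
proof -
  have lim: "limitin (htop (H k) (ip k)) X f sequentially \<longleftrightarrow> converges k X f"
    "limitin (htop (H m) (ip m)) Y g sequentially \<longleftrightarrow> converges m Y g"
    if "\<forall>i. (X i, Y i) \<in> T \<inter> H k \<times> H m" for X Y
    using that by (auto intro!: limitin_iff_converges)
  show ?thesis
    unfolding scale_op_def mem_Collect_eq prod.case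
    by (intro ex_cong1 conj_cong refl) (erule lim)+
qed

text \<open>The weak and the strong form agree: \<open>U j k\<close> is closed and contains the
  relevant pairs of \<open>b j\<close>, and conversely each of its pairs is a limit of core pairs,
  which belong to \<open>b j\<close>.\<close>

lemma b_op_eq_U: "b_op smul H ip L z1 j k = U j k"
proof (intro equalityI subrelI)
  fix f h assume "(f, h) \<in> b_op smul H ip L z1 j k"
  then obtain X Y where XY: "\<And>i. (X i, Y i) \<in> b j \<inter> H k \<times> H (k - 2 * j)"
    and X: "converges k X f" and Y: "converges (k - 2 * j) Y h"
    unfolding b_op_def scale_op_iff by blast
  have "(X i, Y i) \<in> U j k" for i using XY[of i] by (intro b_subset_U) auto
  then show "(f, h) \<in> U j k" using X Y by (rule U_closed)
next
  fix f h assume fh: "(f, h) \<in> U j k"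
  obtain p q where pq: "k \<le> int p" "k - 2 * j \<le> int q" "int p - int q = j"
    by (rule ex_core_exponents)
  obtain X h' where X: "\<And>i. X i \<in> H 0" "converges k (\<lambda>i. (B ^^ p) (X i)) f"
    "converges (k - 2 * j) (\<lambda>i. (B ^^ q) (X i)) h'" "(f, h') \<in> U j k"
    using U_approx[OF pq U_mem(1)[OF fh]] by blast
  have "h' = h" using U_unique X(4) fh by blast
  have mem: "(B ^^ p) (X i) \<in> H k" "(B ^^ q) (X i) \<in> H (k - 2 * j)" for i
    using X(1) pq by (auto intro: core_mem)
  show "(f, h) \<in> b_op smul H ip L z1 j k"
    unfolding b_op_def scale_op_iff
    using X mem b_core[OF X(1) pq(3)] \<open>h' = h\<close>
    by (intro exI[of _ "\<lambda>i. (B ^^ p) (X i)"] exI[of _ "\<lambda>i. (B ^^ q) (X i)"]) simp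
qed

text \<open>The scale provides \<open>H 2\<close> as the domain of some root of
  \<open>(L - z1)\<^sup>2\<close>. This lemma and the next two identify it with the range of
  \<open>B\<close>, the domain of \<open>L\<close>. For \<open>p = 2\<close> and
  \<open>q = 1\<close> the weak identity is one in \<open>H 0\<close> against every
  \<open>x\<close>.\<close>

lemma U_1_2: "(f, h) \<in> U 1 2 \<Longrightarrow> h \<in> H 0 \<and> f = B h"
proof -
  assume fh: "(f, h) \<in> U 1 2"
  have f: "f \<in> H 2" "f \<in> H 0" and h: "h \<in> H 0"
    using U_mem[OF fh] H_mono'[of f 2 0] by auto
  have "ip 0 f x = ip 0 (B h) x" if x: "x \<in> H 0" for x
  proof -
    have "ip 0 f x = ip 2 f ((B ^^ 2) x)"
      using ip_core[OF x _ f, of 2 0] by simp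
    also have "\<dots> = ip 0 h ((B ^^ 1) x)"
      using U_ip[OF fh _ _ _ x, of 2 1] by simp
    also have "\<dots> = ip 0 (B h) x"
      using B_sym[OF h x] by simp
    finally show ?thesis .
  qed
  then have "ip 0 (f - B h) (f - B h) = 0"
    using f h by (simp add: ip_diff_left diff_mem B_mem)
  then have "f - B h = 0"
    using ip_self_eq_0[of "f - B h" 0] f h by (simp add: diff_mem B_mem)
  then show ?thesis using h by simp
qed

lemma B_mem_H_2: "h \<in> H 0 \<Longrightarrow> B h \<in> H 2"
  using U_Range[of h 2 1] U_1_2 U_mem by fastforce

lemma H_2_eq: "f \<in> H 2 \<Longrightarrow> \<exists>h\<in>H 0. f = B h"
  using U_Domain[of f 2 1] U_1_2 by blast

lemma ip_1_B: "h \<in> H 0 \<Longrightarrow> g \<in> H 1 \<Longrightarrow> ip 1 (B h) g = ip 0 h g"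
proof -
  assume h: "h \<in> H 0" and g: "g \<in> H 1"
  then have g0: "g \<in> H 0" using H_mono'[of g 1 0] by simp
  have "ip 1 g (B h) = ip 0 g h"
    using ip_core[OF h _ g g0, of 1 0] by simp
  moreover have "B h \<in> H 1" using core_mem[OF h, of 1 1] by simp
  ultimately show ?thesis
    using ip_commute[of g 1 "B h"] ip_commute[of g 0 h] g g0 h by simp
qed

section \<open>The operator \<open>L\<close> on the scale\<close>

text \<open>Closing the graph commutes with the shift by \<open>z1\<close>, because convergence in
  \<open>H (n + 2)\<close> implies convergence in \<open>H n\<close>. This reduces \<open>L\<close>
  on the scale to the unitary map \<open>U 1 (n + 2)\<close>.\<close>

lemma L_op_iff:
  "(f, g) \<in> L_op H ip L n \<longleftrightarrow> (f, g - smul (complex_of_real z1) f) \<in> U 1 (n + 2)"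
proof
  assume "(f, g) \<in> L_op H ip L n"
  then obtain X Y where XY: "\<And>i. (X i, Y i) \<in> L \<inter> H (n + 2) \<times> H n"
    and X: "converges (n + 2) X f" and Y: "converges n Y g"
    unfolding L_op_def scale_op_iff by blast
  have mem: "X i \<in> H (n + 2)" "X i \<in> H n" "Y i \<in> H n" for i
    using XY[of i] H_mono'[of "X i" "n + 2" n] by auto
  have X': "converges n X f"
    using X by (rule converges_mono[rotated]) simp
  show "(f, g - smul (complex_of_real z1) f) \<in> U 1 (n + 2)"
  proof (rule U_closed)
    show "(X i, Y i - smul (complex_of_real z1) (X i)) \<in> U 1 (n + 2)" for i
    proof (rule b_subset_U)
      have "(X i, Y i - smul (complex_of_real z1) (X i)) \<in> A"
        using XY[of i] by (simp add: A_iff)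
      then show "(X i, Y i - smul (complex_of_real z1) (X i)) \<in> b 1"
        by (simp add: b_nonneg A_eq_B)
    qed (use mem in \<open>simp_all add: diff_mem scale_mem\<close>)
    show "converges (n + 2 - 2 * 1) (\<lambda>i. Y i - smul (complex_of_real z1) (X i))
        (g - smul (complex_of_real z1) f)"
      using Y X' by (simp add: converges_diff converges_scale)
  qed (rule X)
next
  assume fg: "(f, g - smul (complex_of_real z1) f) \<in> U 1 (n + 2)"
  obtain p q where pq: "n + 2 \<le> int p" "n + 2 - 2 * 1 \<le> int q" "int p - int q = 1"
    by (rule ex_core_exponents)
  obtain X h where X: "\<And>i. X i \<in> H 0" "converges (n + 2) (\<lambda>i. (B ^^ p) (X i)) f"
    "converges (n + 2 - 2 * 1) (\<lambda>i. (B ^^ q) (X i)) h" "(f, h) \<in> U 1 (n + 2)"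
    using U_approx[OF pq U_mem(1)[OF fg]] by blast
  have h: "h = g - smul (complex_of_real z1) f" using U_unique X(4) fg by blast
  have p: "p = Suc q" using pq(3) by simp
  have X': "converges n (\<lambda>i. (B ^^ p) (X i)) f"
    using X(2) by (rule converges_mono[rotated]) simp
  \<comment> \<open>This is \<open>L\<close> applied to \<open>(B ^^ p) (X i)\<close>, since
    \<open>p = Suc q\<close> and \<open>L B\<close> is the identity plus \<open>z1\<close> times
    \<open>B\<close>.\<close>
  define Y where "Y i = (B ^^ q) (X i) + smul (complex_of_real z1) ((B ^^ p) (X i))" for i
  have "converges n Y (h + smul (complex_of_real z1) f)"
    unfolding Y_def using X(3) X' by (simp add: converges_add converges_scale)
  then have Y: "converges n Y g" by (simp add: h)
  have XY: "((B ^^ p) (X i), Y i) \<in> L" for i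
    using B_in_L[OF funpow_B_mem[OF X(1)]] by (simp add: Y_def p)
  have mem: "(B ^^ p) (X i) \<in> H (n + 2)" "Y i \<in> H n" for i
    using X(2) Y by (simp_all add: converges_def)
  show "(f, g) \<in> L_op H ip L n"
    unfolding L_op_def scale_op_iff
    using X(2) Y XY mem by (intro exI[of _ "\<lambda>i. (B ^^ p) (X i)"] exI[of _ Y]) simp
qed

lemma L_op_mem: "(f, g) \<in> L_op H ip L n \<Longrightarrow> f \<in> H (n + 2) \<and> f \<in> H n \<and> g \<in> H n"
proof -
  assume fg: "(f, g) \<in> L_op H ip L n"
  then have f2: "f \<in> H (n + 2)" and d: "g - smul (complex_of_real z1) f \<in> H n"
    using U_mem[of f _ 1 "n + 2"] by (simp_all add: L_op_iff)
  have f: "f \<in> H n" using f2 by (rule H_mono') simp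
  then have "g - smul (complex_of_real z1) f + smul (complex_of_real z1) f \<in> H n"
    using d by (intro add_mem scale_mem)
  then show ?thesis using f f2 by simp
qed

lemma L_op_linear_operator: "linear_operator smul (H n) (L_op H ip L n)"
proof (rule linear_operatorI)
  show "L_op H ip L n \<subseteq> H n \<times> H n" using L_op_mem by auto
  show "single_valued (L_op H ip L n)"
    by (rule single_valuedI) (use U_unique in \<open>fastforce simp: L_op_iff\<close>)
  have "(0, 0) \<in> U 1 (n + 2)"
    by (rule U_I) (auto simp: core_mem)
  then show "(0, 0) \<in> L_op H ip L n" by (simp add: L_op_iff)
  show "(f + f', g + g') \<in> L_op H ip L n"
    if "(f, g) \<in> L_op H ip L n" "(f', g') \<in> L_op H ip L n" for f g f' g'
    using U_add[OF that[unfolded L_op_iff]]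
    by (simp add: L_op_iff scale_right_distrib algebra_simps)
  show "(smul c f, smul c g) \<in> L_op H ip L n" if "(f, g) \<in> L_op H ip L n" for c f g
    using U_scale[OF that[unfolded L_op_iff], of c]
    by (simp add: L_op_iff scale_right_diff_distrib mult.commute)
qed

text \<open>For core vectors both sides equal the inner product in \<open>H 0\<close> of
  \<open>x\<close> with \<open>B\<close> to the power \<open>p + q - n\<close> applied to
  \<open>y\<close>. The general case follows by approximating arguments and values
  simultaneously.\<close>

lemma U_1_symmetric:
  assumes fu: "(f, u) \<in> U 1 (n + 2)" and gv: "(g, v) \<in> U 1 (n + 2)"
  shows "ip n u g = ip n f v"
proof -
  obtain p q where pq: "n + 2 \<le> int p" "n + 2 - 2 * 1 \<le> int q" "int p - int q = 1"
    by (rule ex_core_exponents)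
  obtain X u' where X: "\<And>i. X i \<in> H 0" "converges (n + 2) (\<lambda>i. (B ^^ p) (X i)) f"
    "converges (n + 2 - 2 * 1) (\<lambda>i. (B ^^ q) (X i)) u'" "(f, u') \<in> U 1 (n + 2)"
    using U_approx[OF pq U_mem(1)[OF fu]] by blast
  obtain Y v' where Y: "\<And>i. Y i \<in> H 0" "converges (n + 2) (\<lambda>i. (B ^^ p) (Y i)) g"
    "converges (n + 2 - 2 * 1) (\<lambda>i. (B ^^ q) (Y i)) v'" "(g, v') \<in> U 1 (n + 2)"
    using U_approx[OF pq U_mem(1)[OF gv]] by blast
  have "u' = u" "v' = v" using U_unique X(4) Y(4) fu gv by blast+
  have core: "ip n ((B ^^ q) x) ((B ^^ p) y) = ip n ((B ^^ p) x) ((B ^^ q) y)"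
    if x: "x \<in> H 0" and y: "y \<in> H 0" for x y
  proof -
    have n: "n \<le> int p" "n \<le> int q" using pq by auto
    have "ip n ((B ^^ q) x) ((B ^^ p) y) = ip 0 ((B ^^ q) x) ((B ^^ nat (int p - n)) y)"
      using n by (intro ip_core y core_mem x) auto
    also have "\<dots> = ip 0 x ((B ^^ (q + nat (int p - n))) y)"
      using x y by (simp add: funpow_B_sym funpow_B_mem funpow_add)
    also have "q + nat (int p - n) = p + nat (int q - n)"
      using n by simp
    also have "ip 0 x ((B ^^ (p + nat (int q - n))) y) = ip 0 ((B ^^ p) x) ((B ^^ nat (int q - n)) y)"
      using x y by (simp add: funpow_B_sym funpow_B_mem funpow_add)
    also have "\<dots> = ip n ((B ^^ p) x) ((B ^^ q) y)"
      using n by (intro ip_core[symmetric] y core_mem x) auto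
    finally show ?thesis .
  qed
  have Xf: "converges n (\<lambda>i. (B ^^ p) (X i)) f"
    using X(2) by (rule converges_mono[rotated]) simp
  have Yg: "converges n (\<lambda>i. (B ^^ p) (Y i)) g"
    using Y(2) by (rule converges_mono[rotated]) simp
  have Xu: "converges n (\<lambda>i. (B ^^ q) (X i)) u" and Yv: "converges n (\<lambda>i. (B ^^ q) (Y i)) v"
    using X(3) Y(3) \<open>u' = u\<close> \<open>v' = v\<close> by simp_all
  have "(\<lambda>i. ip n ((B ^^ q) (X i)) ((B ^^ p) (Y i))) \<longlonglongrightarrow> ip n u g"
    using Xu Yg by (rule converges_ip)
  moreover have "(\<lambda>i. ip n ((B ^^ p) (X i)) ((B ^^ q) (Y i))) \<longlonglongrightarrow> ip n f v"
    using Xf Yv by (rule converges_ip)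
  ultimately show ?thesis
    using LIMSEQ_unique by (simp add: core X(1) Y(1))
qed

lemma L_op_symmetric:
  assumes fg: "(f, g) \<in> L_op H ip L n" and fg': "(f', g') \<in> L_op H ip L n"
  shows "ip n g f' = ip n f g'"
proof -
  have "ip n (g - smul (complex_of_real z1) f) f' = ip n f (g' - smul (complex_of_real z1) f')"
    using assms unfolding L_op_iff by (rule U_1_symmetric)
  then show ?thesis
    using L_op_mem[OF fg] L_op_mem[OF fg']
    by (simp add: ip_diff_left ip_diff_right ip_scale_left ip_scale_right scale_mem)
qed

lemma L_op_Range: "h \<in> H n \<Longrightarrow> \<exists>f g. (f, g) \<in> L_op H ip L n \<and> g - smul (complex_of_real z1) f = h"
proof -
  assume "h \<in> H n"
  then obtain f where "(f, h) \<in> U 1 (n + 2)" using U_Range[of h "n + 2" 1] by auto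
  then have "(f, h + smul (complex_of_real z1) f) \<in> L_op H ip L n" by (simp add: L_op_iff)
  then show ?thesis by (metis add_diff_cancel_right')
qed

lemma hdense_Domain_L_op: "hdense (H n) (ip n) (Domain (L_op H ip L n))"
proof -
  obtain q where q: "n + 2 \<le> int q" by (metis nat_le_iff order_refl)
  have "f \<in> Domain (L_op H ip L n)" if f: "f \<in> H (n + 2)" for f
  proof -
    obtain h where "(f, h) \<in> U 1 (n + 2)" using U_Domain[OF f] by blast
    then have "(f, h + smul (complex_of_real z1) f) \<in> L_op H ip L n" by (simp add: L_op_iff)
    then show ?thesis by blast
  qed
  then have "(B ^^ q) ` H 0 \<subseteq> Domain (L_op H ip L n)"
    using core_subset[OF q] by blast
  moreover have "hdense (H n) (ip n) ((B ^^ q) ` H 0)"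
    using q by (intro hdense_core) simp
  ultimately show ?thesis unfolding hdense_def by (meson subsetD)
qed

end

section \<open>Compatible families of projections\<close>

locale projection_family = operator_scale +
  fixes M :: "int \<Rightarrow> 'a set" and P :: "int \<Rightarrow> ('a \<times> 'a) set"
  assumes P: "is_orth_projection smul (H n) (ip n) (M n) (P n)"
    and P_incl: "P (n + 1) \<subseteq> P n"
begin

abbreviation pr :: "int \<Rightarrow> 'a \<Rightarrow> 'a"
  where "pr n \<equiv> op_apply (P n)"

lemmas pr_iff = proj_iff[OF P]
  and pr_mem = proj_mem[OF P]
  and pr_sym = proj_sym[OF P]

lemma P_mono: "m \<le> n \<Longrightarrow> P n \<subseteq> P m"
proof (induction n rule: int_ge_induct)
  case (step n)
  then show ?case using P_incl[of n] by blast
qed simp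

lemma pr_mono: "m \<le> n \<Longrightarrow> f \<in> H n \<Longrightarrow> pr n f = pr m f"
  using P_mono[of m n] pr_iff[of f "pr n f" n] pr_iff[of f "pr n f" m] by auto

text \<open>For nonnegative \<open>n\<close> the graph \<open>P n\<close> is contained in
  \<open>P 0\<close>, for negative \<open>n\<close> it is the other way round.\<close>

lemma pr_0: "f \<in> H n \<Longrightarrow> f \<in> H 0 \<Longrightarrow> pr n f = pr 0 f"
  using pr_mono[of 0 n f] pr_mono[of n 0 f] by (cases "0 \<le> n") auto

text \<open>The adjacent projection \<open>P\<^sub>1\<close> mediates between \<open>P\<^sub>0\<close> and \<open>P\<^sub>2\<close>, because
  \<open>\<langle>(L - z\<^sub>1) f, g\<rangle>\<^sub>0 = \<langle>f, g\<rangle>\<^sub>1\<close>.\<close>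

lemma pr_B:
  assumes h: "h \<in> H 0"
  shows "pr 0 (B h) = B (pr 0 h)"
proof -
  have Bh: "B h \<in> H 2" "B h \<in> H 1" "B h \<in> H 0"
    using B_mem_H_2[OF h] H_mono'[of "B h" 2] by auto
  \<comment> \<open>On \<open>H 2\<close> the projection \<open>P 0\<close> acts as
    \<open>P 2\<close>, which stays in \<open>H 2\<close>. The projected vector is therefore again
    in the range of \<open>B\<close>.\<close>
  have "pr 0 (B h) \<in> H 2"
    using pr_0[of "B h" 2] pr_mem[of "B h" 2] Bh by simp
  then obtain u where u: "u \<in> H 0" "pr 0 (B h) = B u"
    using H_2_eq by blast
  \<comment> \<open>The test vectors come from the range of \<open>B\<close>, which is dense in
    \<open>H 0\<close> and contained in \<open>H 1\<close>, so that \<open>P 1\<close> can be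
    applied to them.\<close>
  have "u = pr 0 h"
  proof (rule hdense_ip_eq[OF hdense_core[of 0 1]])
    fix g assume "g \<in> (B ^^ 1) ` H 0"
    then have g: "g \<in> H 1" "g \<in> H 0"
      using core_mem[of _ 1 1] B_mem by auto
    have "ip 0 u g = ip 1 (pr 1 (B h)) g"
      using ip_1_B[OF u(1) g(1)] u(2) pr_0[OF Bh(2,3)] by simp
    also have "\<dots> = ip 1 (B h) (pr 1 g)"
      using Bh(2) g(1) by (rule pr_sym)
    also have "\<dots> = ip 0 h (pr 1 g)"
      using h pr_mem[OF g(1)] by (rule ip_1_B)
    also have "\<dots> = ip 0 (pr 0 h) g"
      using pr_sym[OF h g(2)] pr_0[OF g] by simp
    finally show "ip 0 u g = ip 0 (pr 0 h) g" .
  qed (use u h in \<open>auto simp: pr_mem intro: B_mem\<close>)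
  then show ?thesis using u by simp
qed

lemma pr_funpow_B: "x \<in> H 0 \<Longrightarrow> pr 0 ((B ^^ p) x) = (B ^^ p) (pr 0 x)"
  by (induction p) (auto simp: pr_B funpow_B_mem)

lemma pr_core: "x \<in> H 0 \<Longrightarrow> n \<le> int p \<Longrightarrow> pr n ((B ^^ p) x) = (B ^^ p) (pr 0 x)"
  using pr_0[OF core_mem funpow_B_mem] pr_funpow_B by metis

text \<open>By symmetry the projections move onto the test vectors. There both levels act as
  \<open>P 0\<close> and commute with powers of \<open>B\<close>, so what remains is the test
  condition for \<open>(f, h)\<close> at \<open>pr 0 x\<close>.\<close>

lemma pr_U:
  assumes fh: "(f, h) \<in> U j k"
  shows "(pr k f, pr (k - 2 * j) h) \<in> U j k"
proof (rule U_I)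
  show "pr k f \<in> H k" "pr (k - 2 * j) h \<in> H (k - 2 * j)"
    using U_mem[OF fh] by (simp_all add: pr_mem)
  fix p q x assume pq: "k \<le> int p" "k - 2 * j \<le> int q" "int p - int q = j" and x: "x \<in> H 0"
  have "ip k (pr k f) ((B ^^ p) x) = ip k f ((B ^^ p) (pr 0 x))"
    using pr_sym[OF U_mem(1)[OF fh] core_mem[OF x pq(1)]] pr_core[OF x pq(1)] by simp
  also have "\<dots> = ip (k - 2 * j) h ((B ^^ q) (pr 0 x))"
    using U_ip[OF fh pq] pr_mem[OF x] by simp
  also have "\<dots> = ip (k - 2 * j) (pr (k - 2 * j) h) ((B ^^ q) x)"
    using pr_sym[OF U_mem(2)[OF fh] core_mem[OF x pq(2)]] pr_core[OF x pq(2)] by simp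
  finally show "ip k (pr k f) ((B ^^ p) x) = ip (k - 2 * j) (pr (k - 2 * j) h) ((B ^^ q) x)" .
qed

text \<open>Commutation in \<open>pr_U\<close> becomes conjugation: totality of \<open>U\<close>
  gives the inclusion from left to right, its injectivity the reverse one.\<close>

lemma P_scaling:
  "P (m + 2 * n) =
    b_op smul H ip L z1 n (m + 2 * n) O P m O (b_op smul H ip L z1 n (m + 2 * n))\<inverse>"
  unfolding b_op_eq_U
proof (intro equalityI subrelI)
  fix f g assume "(f, g) \<in> P (m + 2 * n)"
  then have f: "f \<in> H (m + 2 * n)" and g: "g = pr (m + 2 * n) f"
    by (auto simp: pr_iff)
  obtain h where h: "(f, h) \<in> U n (m + 2 * n)" using U_Domain f by blast
  have "(g, pr m h) \<in> U n (m + 2 * n)" using pr_U[OF h] g by simp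
  moreover have "(h, pr m h) \<in> P m" using U_mem(2)[OF h] by (simp add: pr_iff)
  ultimately show "(f, g) \<in> U n (m + 2 * n) O P m O (U n (m + 2 * n))\<inverse>"
    using h by blast
next
  fix f g assume "(f, g) \<in> U n (m + 2 * n) O P m O (U n (m + 2 * n))\<inverse>"
  then obtain h h' where h: "(f, h) \<in> U n (m + 2 * n)" "(h, h') \<in> P m" "(g, h') \<in> U n (m + 2 * n)"
    by blast
  have "(pr (m + 2 * n) f, h') \<in> U n (m + 2 * n)"
    using pr_U[OF h(1)] h(2) by (simp add: pr_iff)
  then have "pr (m + 2 * n) f = g" using h(3) by (rule U_unique')
  then show "(f, g) \<in> P (m + 2 * n)" using U_mem(1)[OF h(1)] by (simp add: pr_iff)
qed

text \<open>The case \<open>j = 1\<close> of \<open>pr_U\<close> projects \<open>f\<close> at level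
  \<open>n + 2\<close> and its image at level \<open>n\<close>; on \<open>H (n + 2)\<close> the two
  projections agree.\<close>

lemma pr_L_op:
  assumes fg: "(f, g) \<in> L_op H ip L n"
  shows "(pr n f, pr n g) \<in> L_op H ip L n"
proof -
  have mem: "f \<in> H (n + 2)" "f \<in> H n" "g \<in> H n" using L_op_mem[OF fg] by auto
  have "(pr (n + 2) f, pr n (g - smul (complex_of_real z1) f)) \<in> U 1 (n + 2)"
    using pr_U[OF fg[unfolded L_op_iff]] by simp
  moreover have "pr (n + 2) f = pr n f" using mem by (intro pr_mono) auto
  ultimately show ?thesis
    using mem by (simp add: L_op_iff proj_diff[OF P] proj_scale[OF P] scale_mem)
qed

lemma reducing_M: "reducing_subspace smul (H n) (ip n) (L_op H ip L n) (M n)"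
  by (rule reducing_subspace_proj_range[OF P L_op_linear_operator hdense_Domain_L_op
        L_op_symmetric L_op_Range pr_L_op])

lemma self_adjoint_part_M: "self_adjoint smul (M n) (ip n) (part_in (L_op H ip L n) (M n))"
  by (rule self_adjoint_part_proj_range[OF P L_op_linear_operator hdense_Domain_L_op
        L_op_symmetric L_op_Range pr_L_op])

text \<open>The complementary projections satisfy the same assumptions, so the claims for
  \<open>Hplus\<close> need no argument of their own.\<close>

lemma projection_family_complement:
  "projection_family smul H ip L z1 (\<lambda>n. orth_complement (H n) (ip n) (M n))
    (\<lambda>n. {(f, f - pr n f) | f. f \<in> H n})"
proof (intro projection_family.intro projection_family_axioms.intro)
  show "operator_scale smul H ip L z1" by (rule operator_scale_axioms)
  show "is_orth_projection smul (H n) (ip n) (orth_complement (H n) (ip n) (M n))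
      {(f, f - pr n f) | f. f \<in> H n}" for n
    by (rule proj_complement[OF P])
  show "{(f, f - pr (n + 1) f) | f. f \<in> H (n + 1)} \<subseteq> {(f, f - pr n f) | f. f \<in> H n}" for n
    using pr_mono[of n "n + 1"] H_Suc[of n] by auto
qed

end

section \<open>Scaling, determination by adjacent projections, and reduction of \<open>L\<close> on
  the whole scale\<close>

theorem theorem5p6:
  fixes smul :: "complex \<Rightarrow> 'a::ab_group_add \<Rightarrow> 'a"
    and H Hminus Hplus :: "int \<Rightarrow> 'a set"
    and ip :: "int \<Rightarrow> 'a \<Rightarrow> 'a \<Rightarrow> complex"
    and L :: "('a \<times> 'a) set"
    and z1 :: real
    and P :: "int \<Rightarrow> ('a \<times> 'a) set"
  assumes L_self_adjoint: "self_adjoint smul (H 0) (ip 0) L"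
    and L_semibounded: "lower_semibounded (ip 0) L"
    and z1: "ereal z1 < (INF z\<in>spectrum smul (H 0) (ip 0) L. ereal (Re z))"
    and H_scale: "hilbert_scale smul L z1 H ip"
    and P: "\<And>n. is_orth_projection smul (H n) (ip n) (Hminus n) (P n)"
    and Hplus: "\<And>n. Hplus n = orth_complement (H n) (ip n) (Hminus n)"
    and P_incl: "\<And>n. P (n + 1) \<subseteq> P n"
  shows
    "(\<forall>m n. P (m + 2 * n) =
        b_op smul H ip L z1 n (m + 2 * n) O P m O (b_op smul H ip L z1 n (m + 2 * n))\<inverse>) \<and>
     (\<forall>n. P (2 * n) =
        b_op smul H ip L z1 n (2 * n) O P 0 O (b_op smul H ip L z1 n (2 * n))\<inverse>) \<and>
     (\<forall>n. P (2 * n + 1) =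
        b_op smul H ip L z1 n (2 * n + 1) O P 1 O (b_op smul H ip L z1 n (2 * n + 1))\<inverse>) \<and>
     (\<forall>Q Kminus.
        (\<forall>n. is_orth_projection smul (H n) (ip n) (Kminus n) (Q n)) \<and>
        (\<forall>n. Q (n + 1) \<subseteq> Q n) \<longrightarrow>
        (\<forall>m. Q m = P m \<and> Q (m + 1) = P (m + 1) \<longrightarrow> Q = P)) \<and>
     (\<forall>n. reducing_subspace smul (H n) (ip n) (L_op H ip L n) (Hminus n) \<and>
          reducing_subspace smul (H n) (ip n) (L_op H ip L n) (Hplus n) \<and>
          self_adjoint smul (Hminus n) (ip n) (part_in (L_op H ip L n) (Hminus n)) \<and>
          self_adjoint smul (Hplus n) (ip n) (part_in (L_op H ip L n) (Hplus n)))"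
proof -
  interpret P: projection_family smul H ip L z1 Hminus P
    by unfold_locales fact+
  interpret Pc: projection_family smul H ip L z1 Hplus "\<lambda>n. {(f, f - P.pr n f) | f. f \<in> H n}"
    using P.projection_family_complement by (simp flip: Hplus)
  have odd: "P (2 * n + 1) =
      b_op smul H ip L z1 n (2 * n + 1) O P 1 O (b_op smul H ip L z1 n (2 * n + 1))\<inverse>" for n
    using P.P_scaling[of 1 n] by (simp add: add.commute)
  have even: "P (2 * n) =
      b_op smul H ip L z1 n (2 * n) O P 0 O (b_op smul H ip L z1 n (2 * n))\<inverse>" for n
    using P.P_scaling[of 0 n] by simp
  have unique: "Q = P"
    if Q: "\<forall>n. is_orth_projection smul (H n) (ip n) (Kminus n) (Q n)" "\<forall>n. Q (n + 1) \<subseteq> Q n"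
      and eq: "Q m = P m" "Q (m + 1) = P (m + 1)" for Q Kminus m
  proof
    fix k
    interpret Q: projection_family smul H ip L z1 Kminus Q
      by unfold_locales (use Q in auto)
    \<comment> \<open>By the parity of \<open>k - m\<close>, level \<open>k\<close> is reached by
      scaling either from \<open>m\<close> or from \<open>m + 1\<close>. Integer division rounds
      down, so this also covers \<open>k < m\<close>.\<close>
    define n where "n = (k - m) div 2"
    have "k = m + 2 * n \<or> k = m + 1 + 2 * n" unfolding n_def by presburger
    then show "Q k = P k"
      using P.P_scaling Q.P_scaling eq by metis
  qed
  show ?thesis
    by (intro conjI allI impI P.P_scaling odd even P.reducing_M Pc.reducing_M
        P.self_adjoint_part_M Pc.self_adjoint_part_M) (blast intro: unique)
qed

end
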